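(* Let $X_\bullet$ be a $2$-Segal set. Then there is a one-to-one correspondence between $\Gamma$-structures on $X_\bullet$ and equivalence classes of commutative structures on the pseudomonoid in $\mathrm{Span}$ corresponding to $X_\bullet$.
   Context: **2-Segal sets.** For a simplicial set $X_\bullet$ write $d_i^n:X_n\to X_{n-1}$ and $s_i^n:X_n\to X_{n+1}$ for face and degeneracy maps (upper indices may be dropped). Let $n\ge 2$ and let $\mathcal T$ be a triangulation of the regular $(n+1)$-gon with vertices labeled $0,\dots,n$ clockwise. Each triangle with vertices $v_0<v_1<v_2$ gives a map $[2]\to[n]$, hence a map $X_n\to X_2$; together these give $\hat{\mathcal T}:X_n\to X_2\times_{X_1}\cdots\times_{X_1}X_2$, where the fibre product consists of families of $2$-simplices indexed by the triangles of $\mathcal T$ whose faces agree along each edge shared by two triangles. $X_\bullet$ is *$2$-Segal* if $\hat{\mathcal T}$ is a bijection for every $n \geq 2$ and every triangulation $\mathcal T$. For the two triangulations of the square the maps are $\hat{\mathcal T}_{13}(\psi)=(d_3\psi,d_1\psi)\in\{(\xi,\xi'):d_1\xi=d_2\xi'\}$ and $\hat{\mathcal T}_{02}(\psi)=(d_2\psi,d_0\psi)\in\{(\xi,\xi'):d_0\xi=d_1\xi'\}$. **The symmetric monoidal bicategory $\mathrm{Span}$.** Objects are sets; a morphism $X\to Y$ is a span $X\xleftarrow{f_1}A\xrightarrow{f_2}Y$ of sets; a $2$-morphism from $X\xleftarrow{f_1}A\xrightarrow{f_2}Y$ to $X\xleftarrow{g_1}B\xrightarrow{g_2}Y$ is a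 map $h:A\to B$ with $g_ih=f_i$ for $i=1,2$; composition is by pullback, identities are identity spans, and associators/unitors are the canonical ones. The monoidal product is the Cartesian product with unit $I=\{\bullet\}$ and canonical structure isomorphisms (suppressed below). The braiding $\rho_{X,Y}:X\times Y\to Y\times X$ is the span $X\times Y\xleftarrow{\mathrm{id}}X\times Y\xrightarrow{\tilde\rho}Y\times X$ with $\tilde\rho$ exchanging components. There are canonical invertible $2$-morphisms $\rho_{f,g}:\rho_{X',Y'}\circ(f\times g)\Rightarrow(g\times f)\circ\rho_{X,Y}$ for $f:X\to X'$, $g:Y\to Y'$ (both sides having apex canonically the product of the apexes of $f$ and $g$); $R_{X|YZ}:(\mathrm{id}_Y\times\rho_{X,Z})\circ(\rho_{X,Y}\times\mathrm{id}_Z)\Rightarrow\rho_{X,Y\times Z}$ (the unique such isomorphism of spans); and $v_{X,Y}:\rho_{Y,X}\circ\rho_{X,Y}\Rightarrow\mathrm{id}_{X\times Y}$ (the unique such isomorphism of spans). **The pseudomonoid corresponding to a $2$-Segal set $X_\bullet$.** The object is $X_1$; the unit $\eta$ is the span $\{\bullet\}\leftarrow X_0\xrightarrow{s_0}X_1$; the multiplication $\mu$ is the span $X_1\times X_1\xleftarrow{(d_2,d_0)}X_2\xrightarrow{d_1}X_1$; the associator $a:\mu\circ(\mu\times\mathrm{id})\Rightarrow\mu\circ(\mathrm{id}\times\mu)$ is $\hat{\mathcal T}_{02}\circ\hat{\mathcal T}_{13}^{-1}$ (identifying the apexes of these composites with $\{(\xi,\xi'):d_1\xi=d_2\xi'\}$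 and $\{(\xi,\xi'):d_0\xi=d_1\xi'\}$ in $X_2\times X_2$); the left unitor $\mu\circ(\eta\times\mathrm{id})\Rightarrow\mathrm{id}$ and right unitor $\mu\circ(\mathrm{id}\times\eta)\Rightarrow\mathrm{id}$ are the inverses of the span maps $x\mapsto(d_1x,s_0x)$ and $x\mapsto(d_0x,s_1x)$. **Commutative structures.** Let a pseudomonoid with object $M$, multiplication $\mu$ and associator $a$ be given. A *commutative structure* on it is an invertible $2$-morphism $\gamma:\mu\Rightarrow\mu\circ\rho_{M,M}$ such that (with whiskerings implicit): (symmetry) the composite $\mu\xRightarrow{\gamma}\mu\circ\rho_{M,M}\xRightarrow{\gamma}\mu\circ\rho_{M,M}\circ\rho_{M,M}$ equals the $2$-morphism induced by $v_{M,M}^{-1}$; (hexagon) the composite $$\mu(\mu\otimes\mathrm{id})\xRightarrow{a}\mu(\mathrm{id}\otimes\mu)\xRightarrow{\gamma}\mu\rho_{M,M}(\mathrm{id}\otimes\mu)\xRightarrow{\rho_{\mathrm{id},\mu}}\mu(\mu\otimes\mathrm{id})\rho_{M,M\otimes M}\xRightarrow{a}\mu(\mathrm{id}\otimes\mu)\rho_{M,M\otimes M}$$ (where $\gamma$ is applied to the outer $\mu$) equals the composite $$\mu(\mu\otimes\mathrm{id})\xRightarrow{\gamma}\mu(\mu\otimes\mathrm{id})(\rho_{M,M}\otimes\mathrm{id})\xRightarrow{a}\mu(\mathrm{id}\otimes\mu)(\rho_{M,M}\otimes\mathrm{id})\xRightarrow{\gamma}\mu(\mathrm{id}\otimes\mu)(\mathrm{id}\otimes\rho_{M,M})(\rho_{M,M}\otimes\mathrm{id})\xRightarrow{R_{M|MM}}\mu(\mathrm{id}\otimes\mu)\rho_{M,M\otimes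 M}$$ (where $\gamma$ is applied to the inner $\mu$ both times). Two commutative structures $\gamma,\gamma'$ on the same fixed pseudomonoid are regarded as equivalent when $\gamma=\gamma'$. **$\Gamma$-structures.** $\Phi_*$ is the category whose objects are the pointed sets $\langle n\rangle=\{\ast,1,\dots,n\}$, $n\ge0$, and whose morphisms are maps preserving $\ast$. A *$\Gamma$-set* is a functor $\Phi_*\to\mathrm{Set}$. The functor $\mathrm{Cut}:\Delta^{\mathrm{op}}\to\Phi_*$ sends $[n]$ to $\langle n\rangle$ and a monotone map $f:[n]\to[m]$ to $\mathrm{Cut}(f):\langle m\rangle\to\langle n\rangle$ with $\mathrm{Cut}(f)(\ast)=\ast$ and, for $1\le i\le m$, $\mathrm{Cut}(f)(i)=\ast$ if $f(0)\ge i$ or $f(n)<i$, and $\mathrm{Cut}(f)(i)=\min\{k:f(k)\ge i\}$ otherwise. The underlying simplicial set of a $\Gamma$-set $Y$ is $Y\circ\mathrm{Cut}$. A *$\Gamma$-structure* on a simplicial set $X_\bullet$ is a $\Gamma$-set whose underlying simplicial set is $X_\bullet$. *)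

theory Defs
  imports Main "HOL-Library.FuncSet"
begin

section \<open>Simplicial sets\<close>

text \<open>
  Morphisms of the simplex category and of pointed finite sets are both maps \<open>{..m} \<rightarrow> {..n}\<close>;
  they are taken to be extensional (value \<open>undefined\<close> off the domain), so that equality of
  functions is equality of morphisms. One record carries the data of a functor from either
  category to sets. All values of a functor are sets over one type \<open>'a\<close>; they
  may overlap, so a large enough \<open>'a\<close> (such as a sum type) accommodates any family of sets.
  In \<open>Ar X m n f\<close> the map \<open>f\<close> goes from the object \<open>m\<close> to the object \<open>n\<close>, irrespective of
  the variance of the functor.
\<close>

record 'a set_functor =
  Ob :: "nat \<Rightarrow> 'a set"
  Ar :: "nat \<Rightarrow> nat \<Rightarrow> (nat \<Rightarrow> nat) \<Rightarrow> 'a \<Rightarrow> 'a"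

definition Delta :: "nat \<Rightarrow> nat \<Rightarrow> (nat \<Rightarrow> nat) set" where
  "Delta m n = {f \<in> {..m} \<rightarrow>\<^sub>E {..n}. mono_on {..m} f}"

definition simplicial_set :: "'a set_functor \<Rightarrow> bool" where
  "simplicial_set X \<longleftrightarrow>
     (\<forall>m n. Ar X m n \<in> Delta m n \<rightarrow>\<^sub>E (Ob X n \<rightarrow>\<^sub>E Ob X m)) \<and>
     (\<forall>n. \<forall>x \<in> Ob X n. Ar X n n (\<lambda>i\<in>{..n}. i) x = x) \<and>
     (\<forall>m n p. \<forall>f \<in> Delta m n. \<forall>g \<in> Delta n p. \<forall>x \<in> Ob X p.
        Ar X m p (compose {..m} g f) x = Ar X m n f (Ar X n p g x))"

definition coface :: "nat \<Rightarrow> nat \<Rightarrow> nat \<Rightarrow> nat" where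
  "coface n i = (\<lambda>k\<in>{..n - 1}. if k < i then k else k + 1)"

definition codegeneracy :: "nat \<Rightarrow> nat \<Rightarrow> nat \<Rightarrow> nat" where
  "codegeneracy n i = (\<lambda>k\<in>{..n + 1}. if k \<le> i then k else k - 1)"

text \<open>The superscript of the face and degeneracy maps is the first numerical argument:
  \<open>face X n i\<close> maps \<open>Ob X n\<close> to \<open>Ob X (n - 1)\<close>, and
  \<open>degeneracy X n i\<close> maps \<open>Ob X n\<close> to \<open>Ob X (n + 1)\<close>.\<close>

definition face :: "'a set_functor \<Rightarrow> nat \<Rightarrow> nat \<Rightarrow> 'a \<Rightarrow> 'a" where
  "face X n i = Ar X (n - 1) n (coface n i)"

definition degeneracy :: "'a set_functor \<Rightarrow> nat \<Rightarrow> nat \<Rightarrow> 'a \<Rightarrow> 'a" where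
  "degeneracy X n i = Ar X (n + 1) n (codegeneracy n i)"


section \<open>Triangulations of polygons and the 2-Segal condition\<close>

text \<open>A triangulation of the \<open>(n+1)\<close>-gon with vertices \<open>0, \<dots>, n\<close> is given by its diagonals: a
  maximal set of pairwise non-crossing diagonals. A chord is the pair of its endpoints
  in increasing order.\<close>

definition polygon_sides :: "nat \<Rightarrow> (nat \<times> nat) set" where
  "polygon_sides n = {(i, j). j \<le> n \<and> (j = i + 1 \<or> (i = 0 \<and> j = n))}"

definition polygon_diagonals :: "nat \<Rightarrow> (nat \<times> nat) set" where
  "polygon_diagonals n = {(i, j). i < j \<and> j \<le> n} - polygon_sides n"

fun crossing :: "nat \<times> nat \<Rightarrow> nat \<times> nat \<Rightarrow> bool" where
  "crossing (i, j) (k, l) \<longleftrightarrow> (i < k \<and> k < j \<and> j < l) \<or> (k < i \<and> i < l \<and> l < j)"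

definition triangulation :: "nat \<Rightarrow> (nat \<times> nat) set \<Rightarrow> bool" where
  "triangulation n D \<longleftrightarrow>
     D \<subseteq> polygon_diagonals n \<and>
     (\<forall>c \<in> D. \<forall>d \<in> D. \<not> crossing c d) \<and>
     (\<forall>c \<in> polygon_diagonals n. (\<forall>d \<in> D. \<not> crossing c d) \<longrightarrow> c \<in> D)"

definition triangles :: "nat \<Rightarrow> (nat \<times> nat) set \<Rightarrow> (nat \<times> nat \<times> nat) set" where
  "triangles n D = {(u, v, w). u < v \<and> v < w \<and>
     {(u, v), (v, w), (u, w)} \<subseteq> polygon_sides n \<union> D}"

fun vertex :: "nat \<times> nat \<times> nat \<Rightarrow> nat \<Rightarrow> nat" where
  "vertex (u, v, w) = (\<lambda>i\<in>{..2}. if i = 0 then u else if i = 1 then v else w)"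

text \<open>The edge opposite to the \<open>r\<close>-th vertex; on 2-simplices it corresponds to the face \<open>d\<^sub>r\<close>.\<close>

fun opposite_edge :: "nat \<times> nat \<times> nat \<Rightarrow> nat \<Rightarrow> nat \<times> nat" where
  "opposite_edge (u, v, w) r = (if r = 0 then (v, w) else if r = 1 then (u, w) else (u, v))"

definition triangle_families ::
    "'a set_functor \<Rightarrow> nat \<Rightarrow> (nat \<times> nat) set \<Rightarrow> (nat \<times> nat \<times> nat \<Rightarrow> 'a) set" where
  "triangle_families X n D = {\<xi> \<in> triangles n D \<rightarrow>\<^sub>E Ob X 2.
     \<forall>t \<in> triangles n D. \<forall>t' \<in> triangles n D. \<forall>r \<le> 2. \<forall>s \<le> 2.
       opposite_edge t r = opposite_edge t' s \<longrightarrow> face X 2 r (\<xi> t) = face X 2 s (\<xi> t')}"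

definition triangulation_map ::
    "'a set_functor \<Rightarrow> nat \<Rightarrow> (nat \<times> nat) set \<Rightarrow> 'a \<Rightarrow> nat \<times> nat \<times> nat \<Rightarrow> 'a" where
  "triangulation_map X n D x = (\<lambda>t\<in>triangles n D. Ar X 2 n (vertex t) x)"

definition two_Segal :: "'a set_functor \<Rightarrow> bool" where
  "two_Segal X \<longleftrightarrow> simplicial_set X \<and>
     (\<forall>n \<ge> 2. \<forall>D. triangulation n D \<longrightarrow>
        bij_betw (triangulation_map X n D) (Ob X n) (triangle_families X n D))"


section \<open>Spans\<close>

text \<open>The objects \<open>X\<close> and \<open>Y\<close> of a span are recorded only through the types of its legs.\<close>

record ('x, 'y, 'a) span =
  apex :: "'a set"
  lleg :: "'a \<Rightarrow> 'x"
  rleg :: "'a \<Rightarrow> 'y"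

definition two_morphism ::
    "('x, 'y, 'a) span \<Rightarrow> ('x, 'y, 'b) span \<Rightarrow> ('a \<Rightarrow> 'b) \<Rightarrow> bool" where
  "two_morphism f g h \<longleftrightarrow> h \<in> apex f \<rightarrow>\<^sub>E apex g \<and>
     (\<forall>a \<in> apex f. lleg g (h a) = lleg f a \<and> rleg g (h a) = rleg f a)"

definition invertible_two_morphism ::
    "('x, 'y, 'a) span \<Rightarrow> ('x, 'y, 'b) span \<Rightarrow> ('a \<Rightarrow> 'b) \<Rightarrow> bool" where
  "invertible_two_morphism f g h \<longleftrightarrow> two_morphism f g h \<and>
     (\<exists>k. two_morphism g f k \<and> compose (apex f) k h = (\<lambda>a\<in>apex f. a) \<and>
          compose (apex g) h k = (\<lambda>b\<in>apex g. b))"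

definition id_span :: "'x set \<Rightarrow> ('x, 'x, 'x) span" where
  "id_span X = \<lparr>apex = X, lleg = id, rleg = id\<rparr>"

text \<open>In the apex of a composite the component of the span applied first comes first.\<close>

definition span_comp ::
    "('y, 'z, 'b) span \<Rightarrow> ('x, 'y, 'a) span \<Rightarrow> ('x, 'z, 'a \<times> 'b) span" (infixl "\<circ>\<^sub>s" 65) where
  "g \<circ>\<^sub>s f = \<lparr>apex = {(a, b). a \<in> apex f \<and> b \<in> apex g \<and> rleg f a = lleg g b},
            lleg = (\<lambda>(a, b). lleg f a), rleg = (\<lambda>(a, b). rleg g b)\<rparr>"

definition span_prod ::
    "('x, 'y, 'a) span \<Rightarrow> ('x', 'y', 'b) span \<Rightarrow> ('x \<times> 'x', 'y \<times> 'y', 'a \<times> 'b) span"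
    (infixr "\<times>\<^sub>s" 75) where
  "f \<times>\<^sub>s g = \<lparr>apex = apex f \<times> apex g, lleg = map_prod (lleg f) (lleg g),
            rleg = map_prod (rleg f) (rleg g)\<rparr>"

definition braid :: "'x set \<Rightarrow> 'y set \<Rightarrow> ('x \<times> 'y, 'y \<times> 'x, 'x \<times> 'y) span" where
  "braid X Y = \<lparr>apex = X \<times> Y, lleg = id, rleg = prod.swap\<rparr>"

fun rassoc :: "('a \<times> 'b) \<times> 'c \<Rightarrow> 'a \<times> 'b \<times> 'c" where
  "rassoc ((a, b), c) = (a, (b, c))"

fun lassoc :: "'a \<times> 'b \<times> 'c \<Rightarrow> ('a \<times> 'b) \<times> 'c" where
  "lassoc (a, (b, c)) = ((a, b), c)"

text \<open>The associativity isomorphism of the Cartesian product is suppressed by replacing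
  \<open>(X \<times> Y) \<times> Z\<close> by \<open>X \<times> (Y \<times> Z)\<close> as source or target of a span.\<close>

definition rassoc_source :: "(('x \<times> 'y) \<times> 'z, 'w, 'a) span \<Rightarrow> ('x \<times> 'y \<times> 'z, 'w, 'a) span" where
  "rassoc_source f = \<lparr>apex = apex f, lleg = rassoc \<circ> lleg f, rleg = rleg f\<rparr>"

definition rassoc_target :: "('w, ('x \<times> 'y) \<times> 'z, 'a) span \<Rightarrow> ('w, 'x \<times> 'y \<times> 'z, 'a) span" where
  "rassoc_target f = \<lparr>apex = apex f, lleg = lleg f, rleg = rassoc \<circ> rleg f\<rparr>"

text \<open>
  The operations below act on the maps between apexes underlying 2-morphisms; only their values
  on the apex of the source span matter. In \<open>whisker_left \<alpha>\<close>, with \<open>\<alpha> : f \<Rightarrow> f'\<close>, the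
  result is \<open>g \<circ>\<^sub>s f \<Rightarrow> g \<circ>\<^sub>s f'\<close>; in \<open>whisker_right \<beta>\<close>, with \<open>\<beta> : g \<Rightarrow> g'\<close>, it is
  \<open>g \<circ>\<^sub>s f \<Rightarrow> g' \<circ>\<^sub>s f\<close>.
\<close>

definition whisker_left :: "('a \<Rightarrow> 'a') \<Rightarrow> 'a \<times> 'b \<Rightarrow> 'a' \<times> 'b" where
  "whisker_left \<alpha> = map_prod \<alpha> id"

definition whisker_right :: "('b \<Rightarrow> 'b') \<Rightarrow> 'a \<times> 'b \<Rightarrow> 'a \<times> 'b'" where
  "whisker_right \<beta> = map_prod id \<beta>"

text \<open>\<open>(h \<circ>\<^sub>s g) \<circ>\<^sub>s f \<Rightarrow> h \<circ>\<^sub>s (g \<circ>\<^sub>s f)\<close> and its inverse\<close>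

definition span_assoc :: "'a \<times> 'b \<times> 'c \<Rightarrow> ('a \<times> 'b) \<times> 'c" where
  "span_assoc = lassoc"

definition span_assoc_inv :: "('a \<times> 'b) \<times> 'c \<Rightarrow> 'a \<times> 'b \<times> 'c" where
  "span_assoc_inv = rassoc"

text \<open>\<open>f \<Rightarrow> f \<circ>\<^sub>s id\<close>\<close>

definition span_unit_inv :: "('x, 'y, 'a) span \<Rightarrow> 'a \<Rightarrow> 'x \<times> 'a" where
  "span_unit_inv f a = (lleg f a, a)"

text \<open>\<open>(g \<circ>\<^sub>s f) \<times>\<^sub>s id \<Rightarrow> (g \<times>\<^sub>s id) \<circ>\<^sub>s (f \<times>\<^sub>s id)\<close> and
  \<open>id \<times>\<^sub>s (g \<circ>\<^sub>s f) \<Rightarrow> (id \<times>\<^sub>s g) \<circ>\<^sub>s (id \<times>\<^sub>s f)\<close>\<close>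

fun split_prod_id :: "('a \<times> 'b) \<times> 'x \<Rightarrow> ('a \<times> 'x) \<times> ('b \<times> 'x)" where
  "split_prod_id ((a, b), x) = ((a, x), (b, x))"

fun split_id_prod :: "'x \<times> 'a \<times> 'b \<Rightarrow> ('x \<times> 'a) \<times> ('x \<times> 'b)" where
  "split_id_prod (x, (a, b)) = ((x, a), (x, b))"

text \<open>\<open>\<rho>\<^bsub>f,g\<^esub> : braid X' Y' \<circ>\<^sub>s (f \<times>\<^sub>s g) \<Rightarrow> (g \<times>\<^sub>s f) \<circ>\<^sub>s braid X Y\<close>\<close>

definition braid_nat ::
    "('x, 'x', 'a) span \<Rightarrow> ('y, 'y', 'b) span \<Rightarrow>
     ('a \<times> 'b) \<times> ('x' \<times> 'y') \<Rightarrow> ('x \<times> 'y) \<times> ('b \<times> 'a)" where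
  "braid_nat f g = (\<lambda>((a, b), _). ((lleg f a, lleg g b), (b, a)))"

text \<open>\<open>R\<^bsub>X|YZ\<^esub> : (id \<times>\<^sub>s braid X Z) \<circ>\<^sub>s (braid X Y \<times>\<^sub>s id) \<Rightarrow> braid X (Y \<times> Z)\<close>\<close>

definition braid_hex :: "(('x \<times> 'y) \<times> 'z) \<times> ('y \<times> 'x \<times> 'z) \<Rightarrow> 'x \<times> 'y \<times> 'z" where
  "braid_hex = (\<lambda>(p, _). rassoc p)"

text \<open>\<open>v\<^bsub>X,Y\<^esub> : braid Y X \<circ>\<^sub>s braid X Y \<Rightarrow> id\<close> and its inverse\<close>

definition braid_syl :: "('x \<times> 'y) \<times> ('y \<times> 'x) \<Rightarrow> 'x \<times> 'y" where
  "braid_syl = fst"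

definition braid_syl_inv :: "'x set \<Rightarrow> 'y set \<Rightarrow> 'x \<times> 'y \<Rightarrow> ('x \<times> 'y) \<times> ('y \<times> 'x)" where
  "braid_syl_inv X Y = inv_into (apex (braid Y X \<circ>\<^sub>s braid X Y)) braid_syl"


section \<open>Pseudomonoids in spans and commutative structures\<close>

text \<open>The 2-morphism components are
  \<open>\<mu> \<circ>\<^sub>s (\<mu> \<times>\<^sub>s id) \<Rightarrow> \<mu> \<circ>\<^sub>s (id \<times>\<^sub>s \<mu>)\<close>, \<open>\<mu> \<circ>\<^sub>s (\<eta> \<times>\<^sub>s id) \<Rightarrow> id\<close> and
  \<open>\<mu> \<circ>\<^sub>s (id \<times>\<^sub>s \<eta>) \<Rightarrow> id\<close>.\<close>

record ('x, 'u, 'm) pseudomonoid =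
  pobj :: "'x set"
  punit :: "(unit, 'x, 'u) span"
  pmult :: "('x \<times> 'x, 'x, 'm) span"
  passoc :: "('m \<times> 'x) \<times> 'm \<Rightarrow> ('x \<times> 'm) \<times> 'm"
  plunit :: "('u \<times> 'x) \<times> 'm \<Rightarrow> 'x"
  prunit :: "('x \<times> 'u) \<times> 'm \<Rightarrow> 'x"

definition symmetry_axiom :: "('x, 'u, 'm) pseudomonoid \<Rightarrow> ('m \<Rightarrow> ('x \<times> 'x) \<times> 'm) \<Rightarrow> bool" where
  "symmetry_axiom P \<gamma> \<longleftrightarrow>
     (\<forall>m \<in> apex (pmult P).
        (span_assoc \<circ> whisker_right \<gamma> \<circ> \<gamma>) m =
        (whisker_left (braid_syl_inv (pobj P) (pobj P)) \<circ> span_unit_inv (pmult P)) m)"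

text \<open>
  Reading from the last factor to the first, and writing \<open>\<rho>\<close> for \<open>braid M M\<close> and
  \<open>\<sigma>\<close> for \<open>braid M (M \<times> M)\<close>, the first composite of the hexagon passes through
    \<open>\<mu>(\<mu> \<times> id)\<close>, \<open>\<mu>(id \<times> \<mu>)\<close>, \<open>(\<mu>\<rho>)(id \<times> \<mu>)\<close>, \<open>\<mu>(\<rho>(id \<times> \<mu>))\<close>,
    \<open>\<mu>((\<mu> \<times> id)\<sigma>)\<close>, \<open>(\<mu>(\<mu> \<times> id))\<sigma>\<close>, \<open>(\<mu>(id \<times> \<mu>))\<sigma>\<close>.
\<close>

definition hexagon_fst ::
    "('x, 'u, 'm) pseudomonoid \<Rightarrow> ('m \<Rightarrow> ('x \<times> 'x) \<times> 'm) \<Rightarrow>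
     ('m \<times> 'x) \<times> 'm \<Rightarrow> ('x \<times> 'x \<times> 'x) \<times> (('x \<times> 'm) \<times> 'm)" where
  "hexagon_fst P \<gamma> =
     whisker_right (passoc P)
     \<circ> span_assoc_inv
     \<circ> whisker_left (braid_nat (id_span (pobj P)) (pmult P))
     \<circ> span_assoc
     \<circ> whisker_right \<gamma>
     \<circ> passoc P"

text \<open>
  The second composite passes through
    \<open>\<mu>(\<mu> \<times> id)\<close>, \<open>\<mu>(\<mu>\<rho> \<times> id)\<close>, \<open>\<mu>((\<mu> \<times> id)(\<rho> \<times> id))\<close>, \<open>(\<mu>(\<mu> \<times> id))(\<rho> \<times> id)\<close>,
    \<open>(\<mu>(id \<times> \<mu>))(\<rho> \<times> id)\<close>, \<open>(\<mu>(id \<times> \<mu>\<rho>))(\<rho> \<times> id)\<close>,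
    \<open>(\<mu>((id \<times> \<mu>)(id \<times> \<rho>)))(\<rho> \<times> id)\<close>, \<open>((\<mu>(id \<times> \<mu>))(id \<times> \<rho>))(\<rho> \<times> id)\<close>,
    \<open>(\<mu>(id \<times> \<mu>))((id \<times> \<rho>)(\<rho> \<times> id))\<close>, \<open>(\<mu>(id \<times> \<mu>))\<sigma>\<close>.
\<close>

definition hexagon_snd ::
    "('x, 'u, 'm) pseudomonoid \<Rightarrow> ('m \<Rightarrow> ('x \<times> 'x) \<times> 'm) \<Rightarrow>
     ('m \<times> 'x) \<times> 'm \<Rightarrow> ('x \<times> 'x \<times> 'x) \<times> (('x \<times> 'm) \<times> 'm)" where
  "hexagon_snd P \<gamma> =
     whisker_left braid_hex
     \<circ> span_assoc
     \<circ> whisker_right span_assoc_inv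
     \<circ> whisker_right (whisker_left split_id_prod)
     \<circ> whisker_right (whisker_left (map_prod id \<gamma>))
     \<circ> whisker_right (passoc P)
     \<circ> span_assoc_inv
     \<circ> whisker_left split_prod_id
     \<circ> whisker_left (map_prod \<gamma> id)"

definition hexagon_axiom :: "('x, 'u, 'm) pseudomonoid \<Rightarrow> ('m \<Rightarrow> ('x \<times> 'x) \<times> 'm) \<Rightarrow> bool" where
  "hexagon_axiom P \<gamma> \<longleftrightarrow>
     (\<forall>z \<in> apex (pmult P \<circ>\<^sub>s rassoc_source (pmult P \<times>\<^sub>s id_span (pobj P))).
        hexagon_fst P \<gamma> z = hexagon_snd P \<gamma> z)"

text \<open>Commutative structures are equivalent only when they are equal, so their equivalence classes
  are the elements of this set.\<close>

definition commutative_structures ::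
    "('x, 'u, 'm) pseudomonoid \<Rightarrow> ('m \<Rightarrow> ('x \<times> 'x) \<times> 'm) set" where
  "commutative_structures P =
     {\<gamma>. invertible_two_morphism (pmult P) (pmult P \<circ>\<^sub>s braid (pobj P) (pobj P)) \<gamma> \<and>
         symmetry_axiom P \<gamma> \<and> hexagon_axiom P \<gamma>}"


section \<open>The pseudomonoid of a 2-Segal set\<close>

definition Segal_unit :: "'a set_functor \<Rightarrow> (unit, 'a, 'a) span" where
  "Segal_unit X = \<lparr>apex = Ob X 0, lleg = (\<lambda>_. ()), rleg = degeneracy X 0 0\<rparr>"

definition Segal_mult :: "'a set_functor \<Rightarrow> ('a \<times> 'a, 'a, 'a) span" where
  "Segal_mult X = \<lparr>apex = Ob X 2, lleg = (\<lambda>\<xi>. (face X 2 2 \<xi>, face X 2 0 \<xi>)), rleg = face X 2 1\<rparr>"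

definition T13 :: "'a set_functor \<Rightarrow> 'a \<Rightarrow> 'a \<times> 'a" where
  "T13 X \<psi> = (face X 3 3 \<psi>, face X 3 1 \<psi>)"

definition T02 :: "'a set_functor \<Rightarrow> 'a \<Rightarrow> 'a \<times> 'a" where
  "T02 X \<psi> = (face X 3 2 \<psi>, face X 3 0 \<psi>)"

text \<open>The apex of \<open>\<mu> \<circ>\<^sub>s (\<mu> \<times>\<^sub>s id)\<close> consists of the \<open>((\<xi>, d\<^sub>0 \<xi>'), \<xi>')\<close> with
  \<open>d\<^sub>1 \<xi> = d\<^sub>2 \<xi>'\<close>. In that of \<open>\<mu> \<circ>\<^sub>s (id \<times>\<^sub>s \<mu>)\<close> the pair \<open>(\<xi>, \<xi>')\<close> with
  \<open>d\<^sub>0 \<xi> = d\<^sub>1 \<xi>'\<close> has \<open>\<xi>\<close> as the outer multiplication, hence as the last component: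
  \<open>((d\<^sub>2 \<xi>, \<xi>'), \<xi>)\<close>.\<close>

definition Segal_assoc :: "'a set_functor \<Rightarrow> ('a \<times> 'a) \<times> 'a \<Rightarrow> ('a \<times> 'a) \<times> 'a" where
  "Segal_assoc X = (\<lambda>((\<xi>, _), \<xi>').
     let (\<zeta>, \<zeta>') = T02 X (inv_into (Ob X 3) (T13 X) (\<xi>, \<xi>'))
     in ((face X 2 2 \<zeta>, \<zeta>'), \<zeta>))"

definition Segal_lunit :: "'a set_functor \<Rightarrow> ('a \<times> 'a) \<times> 'a \<Rightarrow> 'a" where
  "Segal_lunit X = inv_into (Ob X 1) (\<lambda>x. ((face X 1 1 x, x), degeneracy X 1 0 x))"

definition Segal_runit :: "'a set_functor \<Rightarrow> ('a \<times> 'a) \<times> 'a \<Rightarrow> 'a" where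
  "Segal_runit X = inv_into (Ob X 1) (\<lambda>x. ((x, face X 1 0 x), degeneracy X 1 1 x))"

definition Segal_pseudomonoid :: "'a set_functor \<Rightarrow> ('a, 'a, 'a) pseudomonoid" where
  "Segal_pseudomonoid X = \<lparr>pobj = Ob X 1, punit = Segal_unit X, pmult = Segal_mult X,
     passoc = Segal_assoc X, plunit = Segal_lunit X, prunit = Segal_runit X\<rparr>"


section \<open>\<Gamma>-structures\<close>

text \<open>The pointed set \<open>\<langle>n\<rangle>\<close> is \<open>{..n}\<close> with base point \<open>0\<close>.\<close>

definition Pointed :: "nat \<Rightarrow> nat \<Rightarrow> (nat \<Rightarrow> nat) set" where
  "Pointed m n = {f \<in> {..m} \<rightarrow>\<^sub>E {..n}. f 0 = 0}"

definition Gamma_set :: "'a set_functor \<Rightarrow> bool" where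
  "Gamma_set Y \<longleftrightarrow>
     (\<forall>m n. Ar Y m n \<in> Pointed m n \<rightarrow>\<^sub>E (Ob Y m \<rightarrow>\<^sub>E Ob Y n)) \<and>
     (\<forall>n. \<forall>y \<in> Ob Y n. Ar Y n n (\<lambda>i\<in>{..n}. i) y = y) \<and>
     (\<forall>m n p. \<forall>f \<in> Pointed m n. \<forall>g \<in> Pointed n p. \<forall>y \<in> Ob Y m.
        Ar Y m p (compose {..m} g f) y = Ar Y n p g (Ar Y m n f y))"

text \<open>\<open>Cut n m f : \<langle>m\<rangle> \<rightarrow> \<langle>n\<rangle>\<close> for \<open>f : [n] \<rightarrow> [m]\<close>\<close>

definition Cut :: "nat \<Rightarrow> nat \<Rightarrow> (nat \<Rightarrow> nat) \<Rightarrow> nat \<Rightarrow> nat" where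
  "Cut n m f = (\<lambda>i\<in>{..m}. if i = 0 \<or> f 0 \<ge> i \<or> f n < i then 0 else Min {k \<in> {..n}. f k \<ge> i})"

definition underlying_simplicial_set :: "'a set_functor \<Rightarrow> 'a set_functor" where
  "underlying_simplicial_set Y =
     \<lparr>Ob = Ob Y, Ar = (\<lambda>n m. \<lambda>f\<in>Delta n m. Ar Y m n (Cut n m f))\<rparr>"

definition Gamma_structures :: "'a set_functor \<Rightarrow> 'a set_functor set" where
  "Gamma_structures X = {Y. Gamma_set Y \<and> underlying_simplicial_set Y = X}"

end

theory Submission
  imports Defs
begin

text \<open>
  Think of an element of \<open>Ob X n\<close> as a way of multiplying a word of \<open>n\<close> elements of \<open>Ob X 1\<close>, the
  letters of the word being the edges from \<open>i - 1\<close> to \<open>i\<close>. A \<open>\<Gamma>\<close>-structure allows in addition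
  to permute letters and to omit any of them, a commutative structure provides
  only an involution \<open>\<tau>\<close> of \<open>Ob X 2\<close> that exchanges the two factors of a product. Forgetting
  everything about a \<open>\<Gamma>\<close>-structure except the action of the transposition of \<open>\<langle>2\<rangle>\<close> therefore gives a map
  from \<open>\<Gamma>\<close>-structures to commutative structures, and the task is to recover the action of all pointed
  maps from \<open>\<tau>\<close>.

  Writing pointed maps as words in transpositions, faces and degeneracies would require a
  presentation of the category of finite pointed sets. This is avoided by describing a multiplied word in
  a way in which the letters have no order. Under a \<open>\<Gamma>\<close>-structure an element of \<open>Ob X n\<close> has a
  triangle \<open>z A B \<in> Ob X 2\<close> for any two disjoint sets \<open>A\<close>, \<open>B\<close> of letters: the product of the partial
  product over \<open>A\<close> with that over \<open>B\<close>. These triangles satisfy \<open>z B A = \<tau> (z A B)\<close>, they fit into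
  tetrahedra for any three disjoint sets of letters, and the empty product is a degenerate edge. A
  family of triangles with these properties is called coherent below. Pointed maps act on coherent families
  by taking preimages of sets, and this action is functorial for trivial reasons.

  It remains to see that elements of \<open>Ob X n\<close> and coherent families on \<open>n\<close> letters are the same,
  where the element \<open>x\<close> prescribes the triangles \<open>z {i<..j} {j<..k}\<close> for pairs of adjacent intervals.
  This is an induction on \<open>n\<close>. By the 2-Segal condition for the triangulation of a polygon
  by the diagonals from the vertex 0, an element of \<open>Ob X (n + 1)\<close> is an element of
  \<open>Ob X n\<close> glued to a triangle along the total product
  (\<open>eq_by_cone\<close>, \<open>exists_by_cone\<close>). Coherent families can be extended by one letter in exactly the same way
  (\<open>extension_unique\<close>, \<open>extension_exists\<close>); here the new triangles are
  obtained by splitting the given one, their compatibility is Mac Lane's pentagon, which is a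
  consequence of the 2-Segal condition for the pentagon, and the tetrahedra in which the new letter is
  not in the last place come from the hexagon axiom.

  The two results together give the lemmas \<open>coherent_family_exists\<close>,
  \<open>coherent_family_unique\<close>, \<open>resolved_simplex_exists\<close> and \<open>resolved_simplex_unique\<close>, from which it
  follows that \<open>\<tau>\<close> determines a \<open>\<Gamma>\<close>-structure (\<open>Gamma_functor_structure\<close>) and that this is the only
  one with the given \<open>\<tau>\<close> (\<open>Gamma_functor_eq\<close>). Units take care of themselves: every 2-Segal set is
  unital, so that a triangle one of whose factors is a degenerate edge is itself degenerate
  (\<open>degenerate_left\<close>, \<open>degenerate_right\<close>).
\<close>

section \<open>Subsimplices along lists of vertices\<close>

definition vertex_map :: "nat list \<Rightarrow> nat \<Rightarrow> nat" where
  "vertex_map vs = (\<lambda>i\<in>{..length vs - 1}. vs ! i)"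

text \<open>Monotone maps are given by the lists of their values, because simplicial identities between
  explicit lists then reduce, by \<open>sub_sub\<close>, to an evaluation of list entries.\<close>
definition sub_simplex :: "'a set_functor \<Rightarrow> nat \<Rightarrow> nat list \<Rightarrow> 'a \<Rightarrow> 'a" where
  "sub_simplex X n vs = Ar X (length vs - 1) n (vertex_map vs)"

definition vertex_list :: "nat \<Rightarrow> nat list \<Rightarrow> bool" where
  "vertex_list n vs \<longleftrightarrow> vs \<noteq> [] \<and> sorted vs \<and> set vs \<subseteq> {..n}"

lemma vertex_list_simps [simp]:
  "\<not> vertex_list n []"
  "vertex_list n [i] \<longleftrightarrow> i \<le> n"
  "vertex_list n (i # j # vs) \<longleftrightarrow> i \<le> j \<and> vertex_list n (j # vs)"
  by (auto simp: vertex_list_def)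

(* The list [0..<Suc n] stands for the front face and is not to be split up. *)
declare upt_Suc [simp del]

lemma vertex_list_upt [simp]: "vertex_list n [0..<Suc m] \<longleftrightarrow> m \<le> n"
  by (auto simp: vertex_list_def)

lemma vertex_map_in_Delta:
  "vertex_list n vs \<Longrightarrow> length vs = Suc m \<Longrightarrow> vertex_map vs \<in> Delta m n"
  by (auto simp: vertex_list_def Delta_def vertex_map_def mono_on_def sorted_iff_nth_mono
      less_Suc_eq_le set_conv_nth)

locale simplicial =
  fixes X :: "'a set_functor"
  assumes simplicial: "simplicial_set X"
begin

abbreviation sub :: "nat \<Rightarrow> nat list \<Rightarrow> 'a \<Rightarrow> 'a" where
  "sub \<equiv> sub_simplex X"

lemma Ar_closed: "f \<in> Delta m n \<Longrightarrow> x \<in> Ob X n \<Longrightarrow> Ar X m n f x \<in> Ob X m"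
  using simplicial unfolding simplicial_set_def by (blast dest: PiE_mem)

lemma Ar_compose:
  "f \<in> Delta m n \<Longrightarrow> g \<in> Delta n p \<Longrightarrow> x \<in> Ob X p \<Longrightarrow>
     Ar X m n f (Ar X n p g x) = Ar X m p (compose {..m} g f) x"
  using simplicial unfolding simplicial_set_def by simp

lemma sub_closed [simp]:
  "vertex_list n vs \<Longrightarrow> length vs = Suc m \<Longrightarrow> x \<in> Ob X n \<Longrightarrow> sub n vs x \<in> Ob X m"
  unfolding sub_simplex_def by (simp add: Ar_closed vertex_map_in_Delta)

lemma sub_Ar:
  assumes "f \<in> Delta m n" "vertex_list m vs" "x \<in> Ob X n"
  shows "sub m vs (Ar X m n f x) = sub n (map f vs) x"
proof -
  obtain k where k: "length vs = Suc k"
    using assms(2) by (cases vs) (auto simp: vertex_list_def)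
  have "compose {..k} f (vertex_map vs) = vertex_map (map f vs)"
    using k by (auto simp: vertex_map_def compose_def fun_eq_iff)
  then show ?thesis
    using Ar_compose [of "vertex_map vs" k m f n x] vertex_map_in_Delta [OF assms(2) k] assms k
    by (simp add: sub_simplex_def)
qed

lemma sub_sub [simp]:
  assumes "length vs = Suc m" "vertex_list n vs" "vertex_list m ws" "x \<in> Ob X n"
  shows "sub m ws (sub n vs x) = sub n (map ((!) vs) ws) x"
proof -
  have "sub m ws (sub n vs x) = sub n (map (vertex_map vs) ws) x"
    using sub_Ar [OF vertex_map_in_Delta [OF assms(2,1)] assms(3,4)] assms(1)
    by (simp add: sub_simplex_def)
  moreover have "map (vertex_map vs) ws = map ((!) vs) ws"
    using assms(1,3) by (auto simp: vertex_map_def vertex_list_def)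
  ultimately show ?thesis by simp
qed

lemma sub_id: "x \<in> Ob X n \<Longrightarrow> sub n [0..<Suc n] x = x"
proof -
  assume "x \<in> Ob X n"
  moreover have "vertex_map [0..<Suc n] = (\<lambda>i\<in>{..n}. i)"
    by (auto simp: vertex_map_def fun_eq_iff less_Suc_eq_le)
  ultimately show ?thesis
    using simplicial unfolding simplicial_set_def sub_simplex_def
    by simp
qed

lemma sub_id_simps [simp]:
  "x \<in> Ob X 0 \<Longrightarrow> sub 0 [0] x = x"
  "x \<in> Ob X (Suc 0) \<Longrightarrow> sub (Suc 0) [0, Suc 0] x = x"
  "x \<in> Ob X 2 \<Longrightarrow> sub 2 [0, Suc 0, 2] x = x"
  "x \<in> Ob X 3 \<Longrightarrow> sub 3 [0, Suc 0, 2, 3] x = x"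
  using sub_id [of x 0] sub_id [of x 1] sub_id [of x 2] sub_id [of x 3]
  by (simp_all add: upt_rec numeral_2_eq_2 numeral_3_eq_3)

lemma face_eq_sub:
  "face X 2 0 = sub 2 [1, 2]" "face X 2 (Suc 0) = sub 2 [0, 2]" "face X 2 2 = sub 2 [0, 1]"
  "face X 3 0 = sub 3 [1, 2, 3]" "face X 3 (Suc 0) = sub 3 [0, 2, 3]"
  "face X 3 2 = sub 3 [0, 1, 3]" "face X 3 3 = sub 3 [0, 1, 2]"
proof -
  have "coface 2 0 = vertex_map [1, 2]" "coface 2 1 = vertex_map [0, 2]" "coface 2 2 = vertex_map [0, 1]"
    "coface 3 0 = vertex_map [1, 2, 3]" "coface 3 1 = vertex_map [0, 2, 3]"
    "coface 3 2 = vertex_map [0, 1, 3]" "coface 3 3 = vertex_map [0, 1, 2]"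
    by (auto simp: coface_def vertex_map_def fun_eq_iff numeral_2_eq_2 numeral_3_eq_3 le_Suc_eq)
  then show "face X 2 0 = sub 2 [1, 2]" "face X 2 (Suc 0) = sub 2 [0, 2]" "face X 2 2 = sub 2 [0, 1]"
    "face X 3 0 = sub 3 [1, 2, 3]" "face X 3 (Suc 0) = sub 3 [0, 2, 3]"
    "face X 3 2 = sub 3 [0, 1, 3]" "face X 3 3 = sub 3 [0, 1, 2]"
    by (simp_all add: face_def sub_simplex_def numeral_2_eq_2 numeral_3_eq_3)
qed

end

section \<open>Gluing simplices in 2-Segal sets\<close>

lemma Ar_vertex: "Ar X 2 n (vertex (u, v, w)) = sub_simplex X n [u, v, w]"
proof -
  have "vertex (u, v, w) = vertex_map [u, v, w]"
    by (auto simp: vertex_map_def fun_eq_iff numeral_2_eq_2 le_Suc_eq)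
  then show ?thesis by (simp add: sub_simplex_def numeral_2_eq_2)
qed

text \<open>The diagonals from the vertex 0, without the sides \<open>(0, 1)\<close> and \<open>(0, n)\<close> of the polygon.\<close>
definition fan :: "nat \<Rightarrow> (nat \<times> nat) set" where
  "fan n = {(0, i) | i. 2 \<le> i \<and> i < n}"

lemma triangulation_fan: "triangulation n (fan n)"
  unfolding triangulation_def
proof (intro conjI ballI impI)
  show "fan n \<subseteq> polygon_diagonals n"
    by (auto simp: fan_def polygon_diagonals_def polygon_sides_def)
  show "\<not> crossing c d" if "c \<in> fan n" "d \<in> fan n" for c d
    using that by (auto simp: fan_def)
next
  fix c assume c: "c \<in> polygon_diagonals n" "\<forall>d \<in> fan n. \<not> crossing c d"
  obtain i j where ij: "c = (i, j)" by (cases c)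
  show "c \<in> fan n"
  proof (cases "i = 0")
    case True
    then show ?thesis
      using c(1) ij by (auto simp: fan_def polygon_diagonals_def polygon_sides_def)
  next
    case False
    then have "(0, Suc i) \<in> fan n" "crossing c (0, Suc i)"
      using c(1) ij by (auto simp: fan_def polygon_diagonals_def polygon_sides_def)
    then show ?thesis using c(2) by blast
  qed
qed

lemma triangles_fan: "2 \<le> n \<Longrightarrow> triangles n (fan n) = {(0, i, Suc i) | i. 1 \<le> i \<and> i < n}"
  by (auto simp: triangles_def fan_def polygon_sides_def)

lemma triangulation_13: "triangulation 3 {(1, 3)}"
proof -
  have "polygon_diagonals 3 = {(0, 2), (1, 3)}"
    by (auto simp: polygon_diagonals_def polygon_sides_def)
  then show ?thesis by (auto simp: triangulation_def)
qed

lemma triangles_13: "triangles 3 {(1, 3)} = {(0, 1, 3), (1, 2, 3)}"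
  by (auto simp: triangles_def polygon_sides_def)

locale two_Segal_set =
  fixes X :: "'a set_functor"
  assumes two_Segal: "two_Segal X"
begin

sublocale simplicial X
  using two_Segal by unfold_locales (simp add: two_Segal_def)

lemma triangulation_bij:
  "2 \<le> n \<Longrightarrow> triangulation n D \<Longrightarrow>
     bij_betw (triangulation_map X n D) (Ob X n) (triangle_families X n D)"
  using two_Segal by (simp add: two_Segal_def)

lemma eq_by_triangulation:
  assumes "2 \<le> n" "triangulation n D" "x \<in> Ob X n" "y \<in> Ob X n"
    and "\<And>u v w. (u, v, w) \<in> triangles n D \<Longrightarrow> sub n [u, v, w] x = sub n [u, v, w] y"
  shows "x = y"
proof -
  have "triangulation_map X n D x = triangulation_map X n D y"
    using assms(5) by (auto simp: triangulation_map_def fun_eq_iff Ar_vertex simp del: vertex.simps)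
  then show ?thesis
    using triangulation_bij [OF assms(1,2)] assms(3,4) by (meson bij_betw_imp_inj_on inj_onD)
qed

text \<open>The agreement along common edges is expressed by a labelling \<open>E\<close> of all edges, which
  is easier to provide than to compare the edges of any two triangles.\<close>
lemma exists_by_triangulation:
  assumes "2 \<le> n" "triangulation n D"
    and \<phi>: "\<And>u v w. (u, v, w) \<in> triangles n D \<Longrightarrow> \<phi> u v w \<in> Ob X 2 \<and>
      sub 2 [0, 1] (\<phi> u v w) = E u v \<and> sub 2 [1, 2] (\<phi> u v w) = E v w \<and> sub 2 [0, 2] (\<phi> u v w) = E u w"
  shows "\<exists>x \<in> Ob X n. \<forall>u v w. (u, v, w) \<in> triangles n D \<longrightarrow> sub n [u, v, w] x = \<phi> u v w"
proof -
  define \<psi> where "\<psi> = (\<lambda>(u, v, w) \<in> triangles n D. \<phi> u v w)"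
  have face: "face X 2 r (\<psi> t) = case_prod E (opposite_edge t r)" if "t \<in> triangles n D" "r \<le> 2" for t r
  proof -
    obtain u v w where "t = (u, v, w)" by (cases t)
    moreover have "r = 0 \<or> r = 1 \<or> r = 2" using that(2) by auto
    ultimately show ?thesis
      using that(1) \<phi> by (auto simp: \<psi>_def face_eq_sub)
  qed
  have "\<psi> \<in> triangle_families X n D"
    unfolding triangle_families_def using \<phi>
    by (auto simp: face simp del: opposite_edge.simps) (auto simp: \<psi>_def)
  then obtain x where x: "x \<in> Ob X n" "triangulation_map X n D x = \<psi>"
    using triangulation_bij [OF assms(1,2)] by (metis bij_betwE bij_betw_imp_surj_on imageE)
  have "sub n [u, v, w] x = \<phi> u v w" if "(u, v, w) \<in> triangles n D" for u v w
    using fun_cong [OF x(2), of "(u, v, w)"] that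
    by (simp add: triangulation_map_def \<psi>_def Ar_vertex del: vertex.simps)
  then show ?thesis using x(1) by blast
qed

text \<open>In the triangulation by the fan the last triangle is \<open>0, n, n + 1\<close>, and the other ones
  triangulate the face opposite to the last vertex. Hence a simplex is determined by that face and
  that triangle.\<close>
lemma eq_by_cone:
  assumes "x \<in> Ob X (Suc n)" "y \<in> Ob X (Suc n)"
    and front: "sub (Suc n) [0..<Suc n] x = sub (Suc n) [0..<Suc n] y"
    and last: "sub (Suc n) [0, n, Suc n] x = sub (Suc n) [0, n, Suc n] y"
  shows "x = y"
proof (cases "n = 0")
  case True
  have "sub 2 [0, 2] (sub (Suc n) [0, n, Suc n] x) = sub 2 [0, 2] (sub (Suc n) [0, n, Suc n] y)"
    using last by simp
  then show ?thesis using assms(1,2) True by simp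
next
  case False
  have "sub (Suc n) [0, i, Suc i] x = sub (Suc n) [0, i, Suc i] y" if "1 \<le> i" "i < Suc n" for i
  proof (cases "i = n")
    case False
    have "sub n [0, i, Suc i] (sub (Suc n) [0..<Suc n] x) =
        sub n [0, i, Suc i] (sub (Suc n) [0..<Suc n] y)"
      using front by simp
    then show ?thesis using that assms(1,2) False by simp
  qed (use last in simp)
  then show ?thesis
    using eq_by_triangulation [OF _ triangulation_fan assms(1,2)] False by (auto simp: triangles_fan)
qed

lemma eq_by_T13:
  assumes "x \<in> Ob X 3" "y \<in> Ob X 3"
    and "sub 3 [0, 1, 2] x = sub 3 [0, 1, 2] y" "sub 3 [0, 2, 3] x = sub 3 [0, 2, 3] y"
  shows "x = y"
  using eq_by_cone [of x 2 y] assms by (simp add: upt_rec numeral_2_eq_2 numeral_3_eq_3)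

lemma eq_by_T02:
  assumes "x \<in> Ob X 3" "y \<in> Ob X 3"
    and "sub 3 [0, 1, 3] x = sub 3 [0, 1, 3] y" "sub 3 [1, 2, 3] x = sub 3 [1, 2, 3] y"
  shows "x = y"
  using eq_by_triangulation [OF _ triangulation_13 assms(1,2)] assms(3,4)
  unfolding triangles_13 by auto

text \<open>Unitality of 2-Segal sets. If the first edge of \<open>\<xi>\<close> is degenerate, then the
  degenerate tetrahedra \<open>0, 0, 1, 2\<close> and \<open>0, 1, 1, 2\<close> on \<open>\<xi>\<close> agree on two faces that determine a
  3-simplex, so they coincide. The faces opposite to their first vertices are \<open>\<xi>\<close> and
  the degenerate triangle \<open>1, 1, 2\<close>.\<close>
lemma degenerate_left:
  assumes "\<xi> \<in> Ob X 2" "v \<in> Ob X 0" "sub 2 [0, 1] \<xi> = sub 0 [0, 0] v"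
  shows "\<xi> = sub 1 [0, 0, 1] (sub 2 [1, 2] \<xi>)"
proof -
  have "sub 1 ws (sub 2 [0, 1] \<xi>) = sub 1 ws (sub 0 [0, 0] v)" for ws
    using assms(3) by simp
  from this [of "[0, 0, 1]"] this [of "[0, 1, 1]"]
  have "sub 2 [0, 0, 1, 2] \<xi> = sub 2 [0, 1, 1, 2] \<xi>"
    using assms(1,2) by - (rule eq_by_T13; simp)
  then have "sub 3 [1, 2, 3] (sub 2 [0, 0, 1, 2] \<xi>) = sub 3 [1, 2, 3] (sub 2 [0, 1, 1, 2] \<xi>)"
    by simp
  then show ?thesis using assms(1) by simp
qed

lemma degenerate_right:
  assumes "\<xi> \<in> Ob X 2" "v \<in> Ob X 0" "sub 2 [1, 2] \<xi> = sub 0 [0, 0] v"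
  shows "\<xi> = sub 1 [0, 1, 1] (sub 2 [0, 1] \<xi>)"
proof -
  have "sub 1 ws (sub 2 [1, 2] \<xi>) = sub 1 ws (sub 0 [0, 0] v)" for ws
    using assms(3) by simp
  from this [of "[0, 0, 1]"] this [of "[0, 1, 1]"]
  have "sub 2 [0, 1, 1, 2] \<xi> = sub 2 [0, 1, 2, 2] \<xi>"
    using assms(1,2) by - (rule eq_by_T02; simp)
  then have "sub 3 [0, 1, 2] (sub 2 [0, 1, 1, 2] \<xi>) = sub 3 [0, 1, 2] (sub 2 [0, 1, 2, 2] \<xi>)"
    by simp
  then show ?thesis using assms(1) by simp
qed

text \<open>The existence part of gluing a triangle to a simplex. For \<open>n = 0\<close> the statement is
  unitality, for \<open>n = 1\<close> it is trivial, and from then on the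
  fan provides the simplex.\<close>
lemma exists_by_cone:
  assumes x: "x \<in> Ob X n" and \<xi>: "\<xi> \<in> Ob X 2" and edge: "sub n [0, n] x = sub 2 [0, 1] \<xi>"
  shows "\<exists>y \<in> Ob X (Suc n). sub (Suc n) [0..<Suc n] y = x \<and> sub (Suc n) [0, n, Suc n] y = \<xi>"
proof -
  consider "n = 0" | "n = 1" | "2 \<le> n" by linarith
  then show ?thesis
  proof cases
    case 1
    have "sub 1 [1] (sub n [0, n] x) = sub 1 [1] (sub 2 [0, 1] \<xi>)"
      using edge by simp
    then have "sub 1 [0] (sub 2 [1, 2] \<xi>) = x"
      using x \<xi> 1 by simp
    moreover have "\<xi> = sub 1 [0, 0, 1] (sub 2 [1, 2] \<xi>)"
      using degenerate_left [OF \<xi>, of x] x edge 1 by simp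
    ultimately show ?thesis
      using \<xi> 1 by (intro bexI [of _ "sub 2 [1, 2] \<xi>"]) (simp_all add: upt_rec)
  next
    case 2
    then have *: "[0..<Suc n] = [0, 1]" "Suc n = 2" by (simp_all add: upt_rec)
    show ?thesis
      unfolding *(1) unfolding *(2) using assms 2 by (intro bexI [of _ \<xi>]) simp_all
  next
    case 3
    let ?T = "triangles (Suc n) (fan (Suc n))"
    \<comment> \<open>The triangle \<open>\<xi>\<close> is \<open>0, n, n + 1\<close>, and all other triangles of the fan lie in \<open>x\<close>.\<close>
    let ?\<phi> = "\<lambda>u v w. if w \<le> n then sub n [u, v, w] x else \<xi>"
    let ?E = "\<lambda>i j. if j \<le> n then sub n [i, j] x
      else if i = 0 then sub 2 [0, 2] \<xi> else sub 2 [1, 2] \<xi>"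
    have "\<exists>y \<in> Ob X (Suc n). \<forall>u v w. (u, v, w) \<in> ?T \<longrightarrow> sub (Suc n) [u, v, w] y = ?\<phi> u v w"
      using assms 3
      by (intro exists_by_triangulation [where E = ?E])
        (auto simp: triangulation_fan triangles_fan less_Suc_eq_le not_le Suc_le_eq
          dest!: antisym)
    then obtain y where y: "y \<in> Ob X (Suc n)"
      "\<And>i. 1 \<le> i \<Longrightarrow> i \<le> n \<Longrightarrow> sub (Suc n) [0, i, Suc i] y = ?\<phi> 0 i (Suc i)"
      using 3 by (auto simp: triangles_fan)
    have "sub (Suc n) [0..<Suc n] y = x"
      by (rule eq_by_triangulation [OF 3 triangulation_fan])
        (use x y 3 in \<open>auto simp: triangles_fan\<close>)
    then show ?thesis using y 3 by auto
  qed
qed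

lemma exists_by_T13:
  assumes "p \<in> Ob X 2" "q \<in> Ob X 2" "sub 2 [0, 2] p = sub 2 [0, 1] q"
  shows "\<exists>\<psi> \<in> Ob X 3. sub 3 [0, 1, 2] \<psi> = p \<and> sub 3 [0, 2, 3] \<psi> = q"
  using exists_by_cone [of p 2 q] assms by (simp add: upt_rec numeral_2_eq_2 numeral_3_eq_3)

end

section \<open>Associativity as a relation on triangles\<close>

context two_Segal_set begin

text \<open>In terms of the multiplication, \<open>tetra p q r s\<close> means that the associator maps the pair
  \<open>p = (a, b)\<close>, \<open>q = (ab, c)\<close> to the pair \<open>r = (a, bc)\<close>, \<open>s = (b, c)\<close>. By the 2-Segal condition
  either pair determines the other one. The relation is used instead of the associator because it
  treats both directions alike.\<close>
definition tetra :: "'a \<Rightarrow> 'a \<Rightarrow> 'a \<Rightarrow> 'a \<Rightarrow> bool" where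
  "tetra p q r s \<longleftrightarrow> (\<exists>\<psi> \<in> Ob X 3. sub 3 [0, 1, 2] \<psi> = p \<and> sub 3 [0, 2, 3] \<psi> = q \<and>
     sub 3 [0, 1, 3] \<psi> = r \<and> sub 3 [1, 2, 3] \<psi> = s)"

lemma tetra_closed:
  assumes "tetra p q r s"
  shows "p \<in> Ob X 2" "q \<in> Ob X 2" "r \<in> Ob X 2" "s \<in> Ob X 2"
  using assms by (auto simp: tetra_def)

lemma tetra_edges:
  assumes "tetra p q r s"
  shows "sub 2 [0, 2] p = sub 2 [0, 1] q" "sub 2 [1, 2] r = sub 2 [0, 2] s"
    "sub 2 [0, 1] r = sub 2 [0, 1] p" "sub 2 [0, 1] s = sub 2 [1, 2] p"
    "sub 2 [0, 2] r = sub 2 [0, 2] q" "sub 2 [1, 2] s = sub 2 [1, 2] q"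
  using assms by (auto simp: tetra_def)

lemma tetra_exists:
  assumes "p \<in> Ob X 2" "q \<in> Ob X 2" "sub 2 [0, 2] p = sub 2 [0, 1] q"
  obtains r s where "tetra p q r s"
  using exists_by_T13 [OF assms] by (auto simp: tetra_def)

lemma tetra_right_unique:
  assumes "tetra p q r s" "tetra p q r' s'"
  shows "r' = r" "s' = s"
  using assms eq_by_T13 by (metis tetra_def)+

lemma tetra_left_unique:
  assumes "tetra p q r s" "tetra p' q' r s"
  shows "p' = p" "q' = q"
  using assms eq_by_T02 by (metis tetra_def)+

lemma tetra_sub:
  assumes "x \<in> Ob X n" "i \<le> j" "j \<le> k" "k \<le> l" "l \<le> n"
  shows "tetra (sub n [i, j, k] x) (sub n [i, k, l] x) (sub n [i, j, l] x) (sub n [j, k, l] x)"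
  unfolding tetra_def using assms by (intro bexI [of _ "sub n [i, j, k, l] x"]) simp_all

text \<open>The triangles \<open>t012\<close>, \<open>t023\<close>, \<open>t034\<close> form a fan of the pentagon, so they are faces of a
  4-simplex. Since a tetrahedron is determined by its first two faces, the other given triangles are faces of
  this 4-simplex as well, and the conclusion consists of its remaining two tetrahedra.\<close>
lemma pentagon:
  assumes "tetra t012 t023 t013 t123" "tetra t013 t034 t014 t134" "tetra t023 t034 t024 t234"
  obtains t124 where "tetra t012 t024 t014 t124" "tetra t123 t134 t124 t234"
proof -
  obtain \<psi> where \<psi>: "\<psi> \<in> Ob X 3" "sub 3 [0, 1, 2] \<psi> = t012" "sub 3 [0, 2, 3] \<psi> = t023"
      "sub 3 [0, 1, 3] \<psi> = t013" "sub 3 [1, 2, 3] \<psi> = t123"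
    using assms(1) by (auto simp: tetra_def)
  have "sub 3 [0, 3] \<psi> = sub 2 [0, 1] t034"
    using tetra_edges(1) [OF assms(3)] \<psi>(1) unfolding \<psi>(3) [symmetric] by simp
  moreover have "[0..<4] = [0, 1, 2, 3]"
    by (simp add: upt_rec numeral_2_eq_2 numeral_3_eq_3)
  ultimately obtain x where x: "x \<in> Ob X 4" "sub 4 [0, 1, 2, 3] x = \<psi>" "sub 4 [0, 3, 4] x = t034"
    using exists_by_cone [OF \<psi>(1), of t034] tetra_closed(2) [OF assms(2)] by auto
  have x': "sub 4 [0, 1, 2] x = t012" "sub 4 [0, 2, 3] x = t023"
      "sub 4 [0, 1, 3] x = t013" "sub 4 [1, 2, 3] x = t123"
    using x(1) unfolding \<psi>(2-5) [symmetric] x(2) [symmetric] by simp_all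
  note t = tetra_sub [OF x(1)]
  from t [of 0 1 3 4] have 1: "sub 4 [0, 1, 4] x = t014" "sub 4 [1, 3, 4] x = t134"
    using tetra_right_unique [OF assms(2)] x x' by auto
  from t [of 0 2 3 4] have 2: "sub 4 [0, 2, 4] x = t024" "sub 4 [2, 3, 4] x = t234"
    using tetra_right_unique [OF assms(3)] x x' by auto
  show thesis
    using that [of "sub 4 [1, 2, 4] x"] t [of 0 1 2 4] t [of 1 2 3 4] 1 2 x x' by simp
qed

end

section \<open>Coherent families of triangles\<close>

text \<open>A commutative structure with the redundant component in \<open>Ob X 1 \<times> Ob X 1\<close> removed. In terms of
  letters, the last assumption says: if \<open>p\<close>, \<open>q\<close>, \<open>r\<close>, \<open>s\<close> are the triangles of \<open>abc\<close>, then \<open>\<tau> p\<close>, \<open>q\<close>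
  belong to \<open>bac\<close>, and moving \<open>a\<close> past \<open>c\<close> as well gives the same triangles of \<open>bca\<close> as moving
  \<open>a\<close> past \<open>bc\<close> in one step.\<close>
locale braided_two_Segal_set = two_Segal_set +
  fixes \<tau> :: "'a \<Rightarrow> 'a"
  assumes \<tau>_closed [simp]: "\<xi> \<in> Ob X 2 \<Longrightarrow> \<tau> \<xi> \<in> Ob X 2"
    and \<tau>_edges: "\<xi> \<in> Ob X 2 \<Longrightarrow> sub 2 [0, 1] (\<tau> \<xi>) = sub 2 [1, 2] \<xi>"
      "\<xi> \<in> Ob X 2 \<Longrightarrow> sub 2 [1, 2] (\<tau> \<xi>) = sub 2 [0, 1] \<xi>"
      "\<xi> \<in> Ob X 2 \<Longrightarrow> sub 2 [0, 2] (\<tau> \<xi>) = sub 2 [0, 2] \<xi>"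
    and \<tau>_involution [simp]: "\<xi> \<in> Ob X 2 \<Longrightarrow> \<tau> (\<tau> \<xi>) = \<xi>"
    and hexagon: "tetra p q r s \<Longrightarrow> tetra (\<tau> p) q r' s' \<Longrightarrow> tetra s (\<tau> r) r' (\<tau> s')"
begin

text \<open>Of the three tetrahedra in the hexagon, the last two imply the first one, since a tetrahedron
  is determined by the pair \<open>r', \<tau> s'\<close> of its faces.\<close>
lemma hexagon_converse:
  assumes "tetra (\<tau> p) q r' s'" "tetra s (\<tau> r) r' (\<tau> s')" "p \<in> Ob X 2" "r \<in> Ob X 2"
  shows "tetra p q r s"
proof -
  have "sub 2 [0, 2] p = sub 2 [0, 1] q" "q \<in> Ob X 2"
    using tetra_edges(1) [OF assms(1)] tetra_closed(2) [OF assms(1)] assms(3) by (simp_all add: \<tau>_edges)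
  then obtain r0 s0 where rs: "tetra p q r0 s0"
    using tetra_exists assms(3) by metis
  from hexagon [OF this assms(1)] have "s0 = s" "\<tau> r0 = \<tau> r"
    using tetra_left_unique assms(2) by blast+
  then have "r0 = r" using tetra_closed [OF rs] assms(4) \<tau>_involution by metis
  with rs \<open>s0 = s\<close> show ?thesis by simp
qed

text \<open>The symmetry and the tetrahedra in which one of \<open>A\<close>, \<open>B\<close>, \<open>C\<close> is empty enforce that the
  edges of \<open>z A B\<close> depend only on \<open>A\<close>, \<open>B\<close> and \<open>A \<union> B\<close>, see \<open>coherent_edges\<close>. The last
  condition makes the empty product a unit; with unitality it forces all triangles with an empty entry
  to be degenerate.\<close>
definition coherent :: "nat set \<Rightarrow> (nat set \<Rightarrow> nat set \<Rightarrow> 'a) \<Rightarrow> bool" where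
  "coherent S z \<longleftrightarrow>
     (\<forall>A B. A \<union> B \<subseteq> S \<longrightarrow> A \<inter> B = {} \<longrightarrow> z A B \<in> Ob X 2 \<and> z B A = \<tau> (z A B)) \<and>
     (\<forall>A B C. A \<union> B \<union> C \<subseteq> S \<longrightarrow> A \<inter> B = {} \<longrightarrow> A \<inter> C = {} \<longrightarrow> B \<inter> C = {} \<longrightarrow>
        tetra (z A B) (z (A \<union> B) C) (z A (B \<union> C)) (z B C)) \<and>
     (\<exists>v \<in> Ob X 0. sub 2 [0, 1] (z {} {}) = sub 0 [0, 0] v)"

lemma coherentD:
  assumes "coherent S z"
  shows "A \<union> B \<subseteq> S \<Longrightarrow> A \<inter> B = {} \<Longrightarrow> z A B \<in> Ob X 2"
    and "A \<union> B \<subseteq> S \<Longrightarrow> A \<inter> B = {} \<Longrightarrow> z B A = \<tau> (z A B)"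
    and "A \<union> B \<union> C \<subseteq> S \<Longrightarrow> A \<inter> B = {} \<Longrightarrow> A \<inter> C = {} \<Longrightarrow> B \<inter> C = {} \<Longrightarrow>
      tetra (z A B) (z (A \<union> B) C) (z A (B \<union> C)) (z B C)"
    and "\<exists>v \<in> Ob X 0. sub 2 [0, 1] (z {} {}) = sub 0 [0, 0] v"
  using assms unfolding coherent_def by blast+

definition edge :: "(nat set \<Rightarrow> nat set \<Rightarrow> 'a) \<Rightarrow> nat set \<Rightarrow> 'a" where
  "edge z A = sub 2 [0, 1] (z A {})"

lemma coherent_edges:
  assumes z: "coherent S z" and AB: "A \<union> B \<subseteq> S" "A \<inter> B = {}"
  shows "sub 2 [0, 1] (z A B) = edge z A" "sub 2 [1, 2] (z A B) = edge z B"
    "sub 2 [0, 2] (z A B) = edge z (A \<union> B)"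
proof -
  have 1: "sub 2 [0, 1] (z A B) = edge z A" if "A \<union> B \<subseteq> S" "A \<inter> B = {}" for A B
    using that tetra_edges(1) [OF coherentD(3) [OF z, of A "{}" B]]
      tetra_edges(1) [OF coherentD(3) [OF z, of A "{}" "{}"]] by (auto simp: edge_def)
  show "sub 2 [0, 1] (z A B) = edge z A" using 1 AB .
  show "sub 2 [1, 2] (z A B) = edge z B"
    using 1 [of B A] AB coherentD(1,2) [OF z, of A B] by (metis Int_commute Un_commute \<tau>_edges(1))
  show "sub 2 [0, 2] (z A B) = edge z (A \<union> B)"
    using tetra_edges(1) [OF coherentD(3) [OF z, of A B "{}"]] AB by (auto simp: edge_def)
qed

lemma coherent_degenerate:
  assumes z: "coherent S z" and A: "A \<subseteq> S"
  shows "z {} A = sub 1 [0, 0, 1] (edge z A)" "z A {} = sub 1 [0, 1, 1] (edge z A)"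
proof -
  obtain v where v: "v \<in> Ob X 0" "edge z {} = sub 0 [0, 0] v"
    using coherentD(4) [OF z] by (auto simp: edge_def)
  have left: "sub 2 [0, 1] (z {} A) = sub 0 [0, 0] v" "sub 2 [1, 2] (z {} A) = edge z A"
    and right: "sub 2 [0, 1] (z A {}) = edge z A" "sub 2 [1, 2] (z A {}) = sub 0 [0, 0] v"
    using coherent_edges [OF z, of "{}" A] coherent_edges [OF z, of A "{}"] A v by simp_all
  show "z {} A = sub 1 [0, 0, 1] (edge z A)"
    using degenerate_left [OF _ v(1) left(1)] coherentD(1) [OF z, of "{}" A] A
    unfolding left(2) by simp
  show "z A {} = sub 1 [0, 1, 1] (edge z A)"
    using degenerate_right [OF _ v(1) right(2)] coherentD(1) [OF z, of A "{}"] A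
    unfolding right(1) by simp
qed

text \<open>Every triangle involving the new letter \<open>p\<close> is obtained from the
  triangle \<open>z S {p}\<close>: splitting \<open>S\<close> into \<open>S - A\<close> and \<open>A\<close> yields \<open>z A {p}\<close>, splitting \<open>A \<union> B\<close>
  in \<open>z (A \<union> B) {p}\<close> yields \<open>z A (B \<union> {p})\<close>, and \<open>\<tau>\<close> yields the triangles with
  \<open>p\<close> in the first set.\<close>
lemma extension_unique:
  assumes z: "coherent (insert p S) z" and z': "coherent (insert p S) z'" and p: "p \<notin> S"
    and old: "\<And>A B. A \<union> B \<subseteq> S \<Longrightarrow> A \<inter> B = {} \<Longrightarrow> z A B = z' A B"
    and new: "z S {p} = z' S {p}"
    and AB: "A \<union> B \<subseteq> insert p S" "A \<inter> B = {}"
  shows "z A B = z' A B"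
proof -
  have 1: "z A {p} = z' A {p}" if A: "A \<subseteq> S" for A
  proof -
    have "S - A \<union> A \<union> {p} \<subseteq> insert p S" "(S - A) \<inter> A = {}" "(S - A) \<inter> {p} = {}" "A \<inter> {p} = {}"
      using A p by auto
    note * = coherentD(3) [OF z this] coherentD(3) [OF z' this]
    have "S - A \<union> A = S" using A by auto
    moreover have "z (S - A) A = z' (S - A) A" by (rule old) (use A in auto)
    ultimately show ?thesis
      using * new by (metis tetra_right_unique(2))
  qed
  have 2: "z A (insert p B) = z' A (insert p B)" if A: "A \<union> B \<subseteq> S" "A \<inter> B = {}" for A B
  proof -
    have "A \<union> B \<union> {p} \<subseteq> insert p S" "A \<inter> B = {}" "A \<inter> {p} = {}" "B \<inter> {p} = {}"
      using A p by auto
    note * = coherentD(3) [OF z this] coherentD(3) [OF z' this]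
    then show ?thesis
      using tetra_right_unique(1) old [OF A] A 1 [of "A \<union> B"] by auto
  qed
  have 3: "z A B = z' A B" if "p \<in> B" "A \<union> B \<subseteq> insert p S" "A \<inter> B = {}" for A B
    using 2 [of A "B - {p}"] that by (auto simp: insert_absorb)
  consider "p \<in> B" | "p \<in> A" | "p \<notin> A" "p \<notin> B" by blast
  then show ?thesis
  proof cases
    case 2
    then have "z B A = z' B A" using 3 [of A B] AB by (simp add: Un_commute Int_commute)
    then show ?thesis
      using coherentD(2) [OF z, of B A] coherentD(2) [OF z', of B A] AB
      by (simp add: Un_commute Int_commute)
  next
    case 3
    then show ?thesis using old AB by (simp add: subset_insert)
  qed (use 3 AB in auto)
qed

text \<open>It suffices to find tetrahedra with the new letter in the last place: the hexagon for
  moving \<open>C\<close> past \<open>A B\<close> produces the ones with the new letter in the middle, and these, together with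
  its converse, the ones with the new letter in the first place.\<close>
lemma coherent_extensionI:
  assumes sym: "\<And>A B. A \<union> B \<subseteq> insert p S \<Longrightarrow> A \<inter> B = {} \<Longrightarrow> z A B \<in> Ob X 2 \<and> z B A = \<tau> (z A B)"
    and assoc: "\<And>A B C. A \<union> B \<union> C \<subseteq> insert p S \<Longrightarrow> A \<inter> B = {} \<Longrightarrow> A \<inter> C = {} \<Longrightarrow> B \<inter> C = {} \<Longrightarrow>
        p \<notin> A \<union> B \<Longrightarrow> tetra (z A B) (z (A \<union> B) C) (z A (B \<union> C)) (z B C)"
    and unit: "\<exists>v \<in> Ob X 0. sub 2 [0, 1] (z {} {}) = sub 0 [0, 0] v"
  shows "coherent (insert p S) z"
proof -
  define T where "T A B C \<longleftrightarrow> tetra (z A B) (z (A \<union> B) C) (z A (B \<union> C)) (z B C)" for A B C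
  define D where "D A B C \<longleftrightarrow> A \<union> B \<union> C \<subseteq> insert p S \<and> A \<inter> B = {} \<and> A \<inter> C = {} \<and> B \<inter> C = {}" for A B C
  have flip: "z B A = \<tau> (z A B)" "z C B = \<tau> (z B C)" "z C A = \<tau> (z A C)"
      "z (A \<union> B) C = \<tau> (z C (A \<union> B))"  "z C (A \<union> B) \<in> Ob X 2" "z C A \<in> Ob X 2"
      "z B C = \<tau> (z C B)" "z A C = \<tau> (z C A)" if "D A B C" for A B C
  proof -
    have *: "A \<union> B \<subseteq> insert p S" "B \<union> C \<subseteq> insert p S" "C \<union> B \<subseteq> insert p S" "A \<union> C \<subseteq> insert p S"
      "C \<union> A \<subseteq> insert p S" "C \<union> (A \<union> B) \<subseteq> insert p S" "A \<inter> B = {}" "B \<inter> C = {}" "C \<inter> B = {}"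
      "A \<inter> C = {}" "C \<inter> A = {}" "C \<inter> (A \<union> B) = {}"
      using that unfolding D_def by auto
    show "z B A = \<tau> (z A B)" "z C B = \<tau> (z B C)" "z C A = \<tau> (z A C)"
      "z (A \<union> B) C = \<tau> (z C (A \<union> B))"  "z C (A \<union> B) \<in> Ob X 2" "z C A \<in> Ob X 2"
      "z B C = \<tau> (z C B)" "z A C = \<tau> (z C A)"
      by (rule sym [THEN conjunct2] sym [THEN conjunct1]; rule *)+
  qed
  have last: "T A B C" if "D A B C" "p \<notin> A \<union> B" for A B C
    using that assoc unfolding T_def D_def by simp
  have middle: "T A B C" if "D A B C" "p \<in> B" for A B C
  proof -
    have "D C A B" "p \<notin> C \<union> A" "D A C B" using that by (auto simp: D_def)
    then have "T C A B" "T A C B" using last [of C A B] last [of A C B] by auto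
    then have "tetra (z C A) (z (C \<union> A) B) (z C (A \<union> B)) (z A B)"
      "tetra (\<tau> (z C A)) (z (C \<union> A) B) (z A (C \<union> B)) (z C B)"
      using flip(8) [OF that(1)] by (simp_all add: T_def Un_commute)
    from hexagon [OF this] show ?thesis
      using flip(4,7) [OF that(1)] by (simp add: T_def Un_commute)
  qed
  have first: "T C A B" if "D C A B" "p \<in> C" for A B C
  proof -
    have D: "D A C B" "p \<notin> A \<union> B" "D A B C" using that by (auto simp: D_def)
    then have "T A C B" "T A B C" using middle [of A C B] last [of A B C] that(2) by auto
    then have "tetra (\<tau> (z C A)) (z (C \<union> A) B) (z A (C \<union> B)) (z C B)"
      "tetra (z A B) (\<tau> (z C (A \<union> B))) (z A (C \<union> B)) (\<tau> (z C B))"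
      using flip(4,7,8) [OF D(3)] by (simp_all add: T_def Un_commute)
    from hexagon_converse [OF this flip(6,5) [OF D(3)]] show ?thesis
      by (simp add: T_def)
  qed
  have all: "T A B C" if "D A B C" for A B C
    using that first [of A B C] middle [of A B C] last [of A B C] by blast
  show ?thesis
    unfolding coherent_def
    by (intro conjI allI impI unit sym [THEN conjunct1] sym [THEN conjunct2]
        all [unfolded T_def D_def])
qed

text \<open>The triangles forced by \<open>extension_unique\<close> are taken as the definition. By the pentagon for
  the four words \<open>S - (A \<union> B)\<close>, \<open>A\<close>, \<open>B\<close>, \<open>p\<close> the triangle \<open>\<beta> B\<close> for \<open>(B, p)\<close> can also be split off from
  \<open>\<beta> (A \<union> B)\<close>, and then the pentagon for \<open>A\<close>, \<open>B\<close>, \<open>C\<close>, \<open>p\<close> gives the tetrahedra.\<close>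
lemma extension_exists:
  assumes z: "coherent S z" and p: "p \<notin> S" and \<xi>: "\<xi> \<in> Ob X 2" "sub 2 [0, 1] \<xi> = edge z S"
  obtains z' where "coherent (insert p S) z'"
    "\<And>A B. p \<notin> A \<union> B \<Longrightarrow> z' A B = z A B" "z' S {p} = \<xi>"
proof -
  note zD = coherentD [OF z] and zE = coherent_edges [OF z]
  \<comment> \<open>\<open>\<beta> A\<close> is the triangle of \<open>(A, p)\<close>, \<open>\<alpha> A\<close> that of \<open>(S - A, A \<union> {p})\<close>.\<close>
  have "\<exists>r s. tetra (z (S - A) A) \<xi> r s" if A: "A \<subseteq> S" for A
  proof -
    have "S - A \<union> A \<subseteq> S" "(S - A) \<inter> A = {}" "S - A \<union> A = S" using A by auto
    then show ?thesis
      using tetra_exists [OF zD(1) \<xi>(1)] zE(3) \<xi>(2) by metis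
  qed
  then obtain \<alpha> \<beta> where \<beta>: "\<And>A. A \<subseteq> S \<Longrightarrow> tetra (z (S - A) A) \<xi> (\<alpha> A) (\<beta> A)"
    by metis
  \<comment> \<open>\<open>w A B\<close> will be the triangle of \<open>(A, B \<union> {p})\<close>.\<close>
  have "\<exists>r. tetra (z A B) (\<beta> (A \<union> B)) r (\<beta> B)" if AB: "A \<union> B \<subseteq> S" "A \<inter> B = {}" for A B
  proof -
    let ?D = "S - (A \<union> B)"
    have D: "?D \<union> A = S - B" and "A \<subseteq> S" "B \<subseteq> S" "?D \<union> A \<union> B \<subseteq> S" "?D \<inter> A = {}" "?D \<inter> B = {}"
      using AB by auto
    then have "tetra (z ?D A) (z (S - B) B) (z ?D (A \<union> B)) (z A B)"
      using zD(3) [of ?D A B] AB by simp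
    from pentagon [OF this \<beta> \<beta>] AB \<open>B \<subseteq> S\<close> show ?thesis by metis
  qed
  then obtain w where w: "\<And>A B. A \<union> B \<subseteq> S \<Longrightarrow> A \<inter> B = {} \<Longrightarrow> tetra (z A B) (\<beta> (A \<union> B)) (w A B) (\<beta> B)"
    by metis
  have w_assoc: "tetra (z A B) (w (A \<union> B) C) (w A (B \<union> C)) (w B C)"
    if "A \<union> B \<union> C \<subseteq> S" "A \<inter> B = {}" "A \<inter> C = {}" "B \<inter> C = {}" for A B C
  proof -
    have "tetra (z A (B \<union> C)) (\<beta> (A \<union> B \<union> C)) (w A (B \<union> C)) (\<beta> (B \<union> C))"
      "tetra (z (A \<union> B) C) (\<beta> (A \<union> B \<union> C)) (w (A \<union> B) C) (\<beta> C)"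
      "tetra (z B C) (\<beta> (B \<union> C)) (w B C) (\<beta> C)"
      using w [of A "B \<union> C"] w [of "A \<union> B" C] w [of B C] that by (auto simp: Un_assoc)
    then show ?thesis
      using pentagon [OF zD(3) [OF that]] tetra_right_unique by metis
  qed
  define z' where "z' A B = (if p \<in> B then w A (B - {p})
    else if p \<in> A then \<tau> (w B (A - {p})) else z A B)" for A B
  have "coherent (insert p S) z'"
  proof (rule coherent_extensionI)
    fix A B assume AB: "A \<union> B \<subseteq> insert p S" "A \<inter> B = {}"
    have w2: "w A B \<in> Ob X 2" if "A \<union> B \<subseteq> S" "A \<inter> B = {}" for A B
      using tetra_closed(3) [OF w] that by blast
    consider "p \<in> B" "p \<notin> A" "A \<union> (B - {p}) \<subseteq> S" "A \<inter> (B - {p}) = {}"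
      | "p \<in> A" "p \<notin> B" "B \<union> (A - {p}) \<subseteq> S" "B \<inter> (A - {p}) = {}"
      | "p \<notin> A" "p \<notin> B" "A \<union> B \<subseteq> S" using AB by blast
    then show "z' A B \<in> Ob X 2 \<and> z' B A = \<tau> (z' A B)"
      by cases (use w2 zD(1,2) AB in \<open>auto simp: z'_def\<close>)
  next
    fix A B C assume ABC: "A \<union> B \<union> C \<subseteq> insert p S" "A \<inter> B = {}" "A \<inter> C = {}" "B \<inter> C = {}" "p \<notin> A \<union> B"
    show "tetra (z' A B) (z' (A \<union> B) C) (z' A (B \<union> C)) (z' B C)"
    proof (cases "p \<in> C")
      case True
      have "B \<union> C - {p} = B \<union> (C - {p})" using ABC by auto
      moreover have "tetra (z A B) (w (A \<union> B) (C - {p})) (w A (B \<union> (C - {p}))) (w B (C - {p}))"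
        by (rule w_assoc) (use ABC in auto)
      ultimately show ?thesis using True ABC by (simp add: z'_def)
    next
      case False
      then have "A \<union> B \<union> C \<subseteq> S" using ABC by auto
      then show ?thesis using False ABC zD(3) by (simp add: z'_def)
    qed
  qed (use zD(4) in \<open>simp add: z'_def\<close>)
  moreover have "z' S {p} = \<xi>"
  proof -
    have "z {} S = sub 1 [0, 0, 1] (sub 2 [0, 1] \<xi>)" "z S {} = sub 1 [0, 1, 1] (sub 2 [0, 1] \<xi>)"
      using coherent_degenerate [OF z, of S] \<xi>(2) by auto
    then have "z {} S = sub 2 [0, 0, 1] \<xi>" "z S {} = sub 2 [0, 1, 1] \<xi>"
      using \<xi>(1) by simp_all
    then have 1: "tetra (z {} S) \<xi> (sub 2 [0, 0, 2] \<xi>) \<xi>" "tetra (z S {}) \<xi> \<xi> (sub 2 [1, 1, 2] \<xi>)"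
      using tetra_sub [OF \<xi>(1), of 0 0 1 2] tetra_sub [OF \<xi>(1), of 0 1 1 2] \<xi>(1) by simp_all
    then have "\<beta> S = \<xi>" using \<beta> [of S] tetra_right_unique(2) by auto
    then have "w S {} = \<xi>" using w [of S "{}"] 1 tetra_right_unique(1) by auto
    then show ?thesis by (simp add: z'_def)
  qed
  ultimately show thesis using that [of z'] by (simp add: z'_def)
qed

end

section \<open>Simplices as coherent families\<close>

context two_Segal_set begin

lemma eq_by_triangles:
  assumes "x \<in> Ob X n" "y \<in> Ob X n"
    and "\<And>i j k. i \<le> j \<Longrightarrow> j \<le> k \<Longrightarrow> k \<le> n \<Longrightarrow> sub n [i, j, k] x = sub n [i, j, k] y"
  shows "x = y"
  using assms
proof (induction n arbitrary: x y)
  case 0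
  have "sub 2 [0] (sub 0 [0, 0, 0] x) = sub 2 [0] (sub 0 [0, 0, 0] y)"
    using 0 by simp
  then show ?case using 0(1,2) by simp
next
  case (Suc n)
  show ?case
  proof (rule eq_by_cone [OF Suc.prems(1,2)])
    show "sub (Suc n) [0..<Suc n] x = sub (Suc n) [0..<Suc n] y"
      by (rule Suc.IH) (use Suc.prems in simp_all)
  qed (use Suc.prems(3) in simp)
qed

end

context braided_two_Segal_set begin

lemma coherent_subset: "coherent S z \<Longrightarrow> S' \<subseteq> S \<Longrightarrow> coherent S' z"
  unfolding coherent_def by (meson subset_trans)

text \<open>The letters of a word are numbered from 1, so the edge from \<open>i\<close> to \<open>j\<close> is the partial product
  over \<open>{i<..j}\<close>. Equality of indices is admitted in order to cover simplices of dimension 0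
  and 1, whose triangles are all degenerate.\<close>
definition resolves :: "nat \<Rightarrow> 'a \<Rightarrow> (nat set \<Rightarrow> nat set \<Rightarrow> 'a) \<Rightarrow> bool" where
  "resolves n x z \<longleftrightarrow>
     (\<forall>i j k. i \<le> j \<longrightarrow> j \<le> k \<longrightarrow> k \<le> n \<longrightarrow> sub n [i, j, k] x = z {i<..j} {j<..k})"

lemma resolvesD:
  "resolves n x z \<Longrightarrow> i \<le> j \<Longrightarrow> j \<le> k \<Longrightarrow> k \<le> n \<Longrightarrow> sub n [i, j, k] x = z {i<..j} {j<..k}"
  by (simp add: resolves_def)

lemma resolves_front:
  "x \<in> Ob X (Suc n) \<Longrightarrow> resolves (Suc n) x z \<Longrightarrow> resolves n (sub (Suc n) [0..<Suc n] x) z"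
  by (simp add: resolves_def)

lemma resolves_edge:
  assumes "x \<in> Ob X n" "resolves n x z" "i \<le> j" "j \<le> n"
  shows "sub n [i, j] x = edge z {i<..j}"
proof -
  have "sub 2 [0, 1] (sub n [i, j, j] x) = edge z {i<..j}"
    using resolvesD [OF assms(2,3) _ assms(4)] by (simp add: edge_def)
  then show ?thesis using assms by simp
qed

lemma greaterThanAtMost_Suc: "{0<..Suc n} = insert (Suc n) {0<..n}"
  by auto

lemma interval_subset: "k \<le> n \<Longrightarrow> {i<..k} \<subseteq> {0<..n::nat}"
  by auto

text \<open>The triangles of a simplex are determined by those of its front face and by the triangle
  \<open>0, n, n + 1\<close> through the same tetrahedra that determine the triangles of a coherent family.\<close>
lemma resolves_Suc:
  assumes x: "x \<in> Ob X (Suc n)" and z: "coherent {0<..Suc n} z"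
    and front: "resolves n (sub (Suc n) [0..<Suc n] x) z"
    and last: "sub (Suc n) [0, n, Suc n] x = z {0<..n} {n<..Suc n}"
  shows "resolves (Suc n) x z"
proof -
  let ?s = "\<lambda>vs. sub (Suc n) vs x"
  have old: "?s [i, j, k] = z {i<..j} {j<..k}" if "i \<le> j" "j \<le> k" "k \<le> n" for i j k
    using resolvesD [OF front that] x that by simp
  have zt: "tetra (z {i<..j} {j<..k}) (z {i<..k} {k<..l}) (z {i<..j} {j<..l}) (z {j<..k} {k<..l})"
    if "i \<le> j" "j \<le> k" "k \<le> l" "l \<le> Suc n" for i j k l
  proof -
    have "{i<..j} \<union> {j<..k} = {i<..k}" "{j<..k} \<union> {k<..l} = {j<..l}"
      using that by auto
    then show ?thesis
      using coherentD(3) [OF z, of "{i<..j}" "{j<..k}" "{k<..l}"] that by fastforce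
  qed
  note xt = tetra_sub [OF x]
  have tip: "?s [j, n, Suc n] = z {j<..n} {n<..Suc n}" if "j \<le> n" for j
  proof -
    have "tetra (z {0<..j} {j<..n}) (z {0<..n} {n<..Suc n}) (?s [0, j, Suc n]) (?s [j, n, Suc n])"
      using xt [of 0 j n "Suc n"] old [of 0 j n] last that by simp
    then show ?thesis
      using tetra_right_unique(2) [OF zt [of 0 j n "Suc n"]] that by simp
  qed
  have new: "?s [i, j, Suc n] = z {i<..j} {j<..Suc n}" if "i \<le> j" "j \<le> n" for i j
  proof -
    have "tetra (z {i<..j} {j<..n}) (z {i<..n} {n<..Suc n}) (?s [i, j, Suc n]) (?s [j, n, Suc n])"
      using xt [of i j n "Suc n"] old [of i j n] tip [of i] that by simp
    then show ?thesis
      using tetra_right_unique(1) [OF zt [of i j n "Suc n"]] that by simp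
  qed
  have degenerate: "?s [i, Suc n, Suc n] = z {i<..Suc n} {}"
    if "?s [i, Suc n] = edge z {i<..Suc n}" "i \<le> Suc n" for i
  proof -
    have "sub 1 [0, 1, 1] (?s [i, Suc n]) = z {i<..Suc n} {}"
      using coherent_degenerate(2) [OF z interval_subset [of "Suc n"]] that by simp
    then show ?thesis using x that(2) by simp
  qed
  have edge: "?s [i, Suc n] = edge z {i<..Suc n}" if "i \<le> n" for i
  proof -
    have "sub 2 [0, 2] (?s [i, n, Suc n]) = edge z ({i<..n} \<union> {n<..Suc n})"
      unfolding tip [OF that] by (rule coherent_edges(3) [OF z]) auto
    moreover have "{i<..n} \<union> {n<..Suc n} = {i<..Suc n}" using that by auto
    ultimately show ?thesis using x that by simp
  qed
  have tip_degenerate: "?s [n, Suc n, Suc n] = z {n<..Suc n} {}"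
    using degenerate [OF edge, of n] by simp
  have "sub 2 [1, 2] (?s [n, Suc n, Suc n]) = edge z {}"
    unfolding tip_degenerate by (rule coherent_edges(2) [OF z]) auto
  then have "?s [Suc n, Suc n] = edge z {Suc n<..Suc n}" using x by simp
  with edge degenerate have "?s [i, Suc n, Suc n] = z {i<..Suc n} {}" if "i \<le> Suc n" for i
    using that by (metis le_SucE)
  with old new show ?thesis
    unfolding resolves_def by (auto simp: le_Suc_eq)
qed

text \<open>The family of the front face is extended by the triangle \<open>0, n, n + 1\<close>. In dimension 0 the only
  triangle is the doubly degenerate one; it is fixed by \<open>\<tau>\<close> because \<open>\<tau>\<close> preserves its edges, which
  are degenerate, and a triangle with degenerate first edge is determined by its last one.\<close>
lemma coherent_family_exists:
  "x \<in> Ob X n \<Longrightarrow> \<exists>z. coherent {0<..n} z \<and> resolves n x z"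
proof (induction n arbitrary: x)
  case 0
  let ?\<xi> = "sub 0 [0, 0, 0] x"
  have \<xi>: "?\<xi> \<in> Ob X 2" using 0 by simp
  have "sub 2 [0, 1] (\<tau> ?\<xi>) = sub 0 [0, 0] x" "sub 2 [1, 2] (\<tau> ?\<xi>) = sub 0 [0, 0] x"
    using \<tau>_edges [OF \<xi>] 0 by simp_all
  then have "\<tau> ?\<xi> = sub 1 [0, 0, 1] (sub 0 [0, 0] x)"
    using degenerate_left [OF \<tau>_closed [OF \<xi>] 0] by metis
  then have "\<tau> ?\<xi> = ?\<xi>" using 0 by simp
  then have "coherent {0<..0} (\<lambda>_ _. ?\<xi>)"
    unfolding coherent_def using \<xi> tetra_sub [OF 0, of 0 0 0 0] 0 by auto
  then show ?case by (auto simp: resolves_def)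
next
  case (Suc n)
  let ?x = "sub (Suc n) [0..<Suc n] x" and ?\<xi> = "sub (Suc n) [0, n, Suc n] x"
  have x: "?x \<in> Ob X n" using Suc.prems by simp
  then obtain z where z: "coherent {0<..n} z" "resolves n ?x z" using Suc.IH by blast
  have "sub 2 [0, 1] ?\<xi> = edge z {0<..n}" "?\<xi> \<in> Ob X 2"
    using resolves_edge [OF x z(2), of 0 n] Suc.prems by simp_all
  then obtain z' where z': "coherent (insert (Suc n) {0<..n}) z'"
    "\<And>A B. Suc n \<notin> A \<union> B \<Longrightarrow> z' A B = z A B" "z' {0<..n} {Suc n} = ?\<xi>"
    using extension_exists [OF z(1), of "Suc n" ?\<xi>] by auto
  have "coherent {0<..Suc n} z'" using z'(1) by (simp add: greaterThanAtMost_Suc)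
  moreover have "resolves n ?x z'"
    using z(2) z'(2) unfolding resolves_def by simp
  moreover have "{n<..Suc n} = {Suc n}" by auto
  ultimately have "resolves (Suc n) x z'"
    using resolves_Suc [OF Suc.prems] z'(3) by simp
  with \<open>coherent {0<..Suc n} z'\<close> show ?case by blast
qed

lemma coherent_family_unique:
  "x \<in> Ob X n \<Longrightarrow> coherent {0<..n} z \<Longrightarrow> resolves n x z \<Longrightarrow> coherent {0<..n} z' \<Longrightarrow>
     resolves n x z' \<Longrightarrow> A \<union> B \<subseteq> {0<..n} \<Longrightarrow> A \<inter> B = {} \<Longrightarrow> z A B = z' A B"
proof (induction n arbitrary: x A B)
  case 0
  then have "A = {}" "B = {}" by auto
  then show ?case
    using resolvesD [OF 0(3), of 0 0 0] resolvesD [OF 0(5), of 0 0 0] by simp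
next
  case (Suc n)
  let ?x = "sub (Suc n) [0..<Suc n] x"
  have sub: "{0<..n} \<subseteq> {0<..Suc n}" by auto
  have eq: "{n<..Suc n} = {Suc n}" by auto
  show ?case
  proof (rule extension_unique [of "Suc n" "{0<..n}"])
    show "z A B = z' A B" if "A \<union> B \<subseteq> {0<..n}" "A \<inter> B = {}" for A B
      using Suc.IH [of ?x, OF _ coherent_subset [OF Suc.prems(2) sub] resolves_front [OF Suc.prems(1,3)]
          coherent_subset [OF Suc.prems(4) sub] resolves_front [OF Suc.prems(1,5)] that] Suc.prems(1)
      by simp
    show "z {0<..n} {Suc n} = z' {0<..n} {Suc n}"
      using resolvesD [OF Suc.prems(3), of 0 n "Suc n"] resolvesD [OF Suc.prems(5), of 0 n "Suc n"] eq
      by simp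
  qed (use Suc.prems in \<open>auto simp: greaterThanAtMost_Suc\<close>)
qed

lemma resolved_simplex_exists:
  "coherent {0<..n} z \<Longrightarrow> \<exists>x \<in> Ob X n. resolves n x z"
proof (induction n)
  case 0
  then obtain v where v: "v \<in> Ob X 0" "edge z {} = sub 0 [0, 0] v"
    using coherentD(4) unfolding edge_def by blast
  then have "z {} {} = sub 0 [0, 0, 0] v"
    using coherent_degenerate(1) [OF 0, of "{}"] by simp
  then show ?case using v(1) by (auto simp: resolves_def)
next
  case (Suc n)
  have S: "{0<..n} \<union> {n<..Suc n} \<subseteq> {0<..Suc n}" "{0<..n} \<inter> {n<..Suc n} = {}" by auto
  have "coherent {0<..n} z" by (rule coherent_subset [OF Suc.prems]) auto
  then obtain x where x: "x \<in> Ob X n" "resolves n x z" using Suc.IH by blast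
  let ?\<xi> = "z {0<..n} {n<..Suc n}"
  have "?\<xi> \<in> Ob X 2" "sub n [0, n] x = sub 2 [0, 1] ?\<xi>"
    using coherentD(1) [OF Suc.prems S] coherent_edges(1) [OF Suc.prems S] resolves_edge [OF x, of 0 n]
    by simp_all
  then obtain y where y: "y \<in> Ob X (Suc n)" "sub (Suc n) [0..<Suc n] y = x"
    "sub (Suc n) [0, n, Suc n] y = ?\<xi>"
    using exists_by_cone [OF x(1)] by blast
  then show ?case using resolves_Suc [OF y(1) Suc.prems] x by auto
qed

lemma resolved_simplex_unique:
  "x \<in> Ob X n \<Longrightarrow> y \<in> Ob X n \<Longrightarrow> resolves n x z \<Longrightarrow> resolves n y z \<Longrightarrow> x = y"
  using eq_by_triangles [of x n y] by (simp add: resolves_def)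

end

section \<open>Preimages under pointed maps\<close>

definition fiber :: "nat \<Rightarrow> (nat \<Rightarrow> nat) \<Rightarrow> nat set \<Rightarrow> nat set" where
  "fiber m f A = {a \<in> {..m}. f a \<in> A}"

lemma fiber_simps [simp]:
  "fiber m f {} = {}" "fiber m f (A \<union> B) = fiber m f A \<union> fiber m f B"
  by (auto simp: fiber_def)

lemma fiber_id: "A \<subseteq> {..m} \<Longrightarrow> fiber m (\<lambda>i\<in>{..m}. i) A = A"
  by (auto simp: fiber_def)

lemma Pointed_bound: "f \<in> Pointed m n \<Longrightarrow> a \<le> m \<Longrightarrow> f a \<le> n"
  unfolding Pointed_def by (metis (no_types, lifting) PiE_mem atMost_iff mem_Collect_eq)

lemma Pointed_0: "f \<in> Pointed m n \<Longrightarrow> f 0 = 0"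
  by (simp add: Pointed_def)

lemma fiber_subset: "f \<in> Pointed m n \<Longrightarrow> 0 \<notin> A \<Longrightarrow> fiber m f A \<subseteq> {0<..m}"
  using Pointed_0 [of f m n] by (fastforce simp: fiber_def intro: gr0I)

lemma fiber_compose: "f \<in> Pointed m n \<Longrightarrow> fiber m (compose {..m} g f) A = fiber m f (fiber n g A)"
  by (auto simp: fiber_def compose_def Pointed_bound)

lemma Pointed_compose:
  "f \<in> Pointed m n \<Longrightarrow> g \<in> Pointed n p \<Longrightarrow> compose {..m} g f \<in> Pointed m p"
  by (auto simp: Pointed_def compose_def)

lemma Pointed_id: "(\<lambda>i\<in>{..n}. i) \<in> Pointed n n"
  by (auto simp: Pointed_def)

lemma Cut_in_Pointed: "Cut n m f \<in> Pointed m n"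
proof -
  have "Min {k \<in> {..n}. f k \<ge> i} \<le> n" if "\<not> f n < i" for i
    using that by (intro order.trans [OF Min_le [of _ n]]) auto
  then show ?thesis by (auto simp: Pointed_def Cut_def)
qed

text \<open>This is what the functor \<open>Cut\<close> is made for: the letters of the edge from \<open>j\<close> to \<open>k\<close>
  of a subsimplex are those between the images of \<open>j\<close> and \<open>k\<close>.\<close>
lemma fiber_Cut:
  assumes f: "f \<in> Delta n m" and jk: "j \<le> k" "k \<le> n"
  shows "fiber m (Cut n m f) {j<..k} = {f j<..f k}"
proof -
  have mono: "f a \<le> f b" if "a \<le> b" "b \<le> n" for a b
    using f that by (auto simp: Delta_def mono_on_def)
  have bound: "f a \<le> m" if "a \<le> n" for a
    using f that unfolding Delta_def by (metis (no_types, lifting) PiE_mem atMost_iff mem_Collect_eq)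
  have "Cut n m f i \<in> {j<..k} \<longleftrightarrow> i \<in> {f j<..f k}" if i: "i \<le> m" for i
  proof (cases "i = 0 \<or> f 0 \<ge> i \<or> f n < i")
    case True
    then have "Cut n m f i = 0" using i by (simp add: Cut_def)
    moreover have "f 0 \<le> f j" "f k \<le> f n" using mono jk by auto
    ultimately show ?thesis using True by auto
  next
    case False
    let ?K = "{k \<in> {..n}. f k \<ge> i}"
    have K: "finite ?K" "?K \<noteq> {}" using False by auto
    have le: "Min ?K \<le> a \<longleftrightarrow> i \<le> f a" if "a \<le> n" for a
    proof
      assume "Min ?K \<le> a"
      then have "f (Min ?K) \<le> f a" using mono that by simp
      moreover have "i \<le> f (Min ?K)" using Min_in [OF K] by simp
      ultimately show "i \<le> f a" by simp
    next
      assume "i \<le> f a"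
      then show "Min ?K \<le> a" using K(1) that by (intro Min_le) auto
    qed
    have "Cut n m f i = Min ?K" using False i by (simp add: Cut_def)
    then show ?thesis using le [of j] le [of k] jk by (auto simp: not_le [symmetric])
  qed
  then show ?thesis using bound [of k] jk by (fastforce simp: fiber_def)
qed

section \<open>The \<Gamma>-structure of a braiding\<close>

context braided_two_Segal_set begin

definition pushforward :: "nat \<Rightarrow> (nat \<Rightarrow> nat) \<Rightarrow> (nat set \<Rightarrow> nat set \<Rightarrow> 'a) \<Rightarrow> nat set \<Rightarrow> nat set \<Rightarrow> 'a" where
  "pushforward m f z = (\<lambda>A B. z (fiber m f A) (fiber m f B))"

text \<open>Taking preimages preserves unions, disjointness and the empty set, and preimages of sets of
  letters do not contain the base point.\<close>
lemma coherent_pushforward: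
  assumes f: "f \<in> Pointed m n" and z: "coherent {0<..m} z"
  shows "coherent {0<..n} (pushforward m f z)"
proof -
  have sub: "fiber m f A \<subseteq> {0<..m}" if "A \<subseteq> {0<..n}" for A
    by (rule fiber_subset [OF f]) (use that in auto)
  have disj: "fiber m f A \<inter> fiber m f B = {}" if "A \<inter> B = {}" for A B
    using that by (auto simp: fiber_def)
  show ?thesis
    unfolding coherent_def pushforward_def fiber_simps
    using coherentD(4) [OF z]
    by (intro conjI allI impI coherentD(1-3) [OF z] disj Un_least sub) auto
qed

text \<open>The coherent family of \<open>x\<close> is pushed forward and turned into a simplex again. The family
  is unique only on disjoint subsets of the letters, which is all that matters for the result.\<close>
definition action :: "nat \<Rightarrow> nat \<Rightarrow> (nat \<Rightarrow> nat) \<Rightarrow> 'a \<Rightarrow> 'a" where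
  "action m n f x = (THE y. y \<in> Ob X n \<and>
     (\<exists>z. coherent {0<..m} z \<and> resolves m x z \<and> resolves n y (pushforward m f z)))"

lemma action_eqI:
  assumes f: "f \<in> Pointed m n" and x: "x \<in> Ob X m" "coherent {0<..m} z" "resolves m x z"
    and y: "y \<in> Ob X n" "resolves n y (pushforward m f z)"
  shows "action m n f x = y"
  unfolding action_def
proof (rule the_equality)
  fix y' assume "y' \<in> Ob X n \<and>
     (\<exists>z. coherent {0<..m} z \<and> resolves m x z \<and> resolves n y' (pushforward m f z))"
  then obtain z' where y': "y' \<in> Ob X n" and z': "coherent {0<..m} z'" "resolves m x z'"
    and res: "resolves n y' (pushforward m f z')" by blast
  have "pushforward m f z' {i<..j} {j<..k} = pushforward m f z {i<..j} {j<..k}" for i j k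
    unfolding pushforward_def
    by (rule coherent_family_unique [OF x(1) z' x(2,3)])
      (use fiber_subset [OF f, of "{i<..j}"] fiber_subset [OF f, of "{j<..k}"] in \<open>auto simp: fiber_def\<close>)
  then have "resolves n y' (pushforward m f z)" using res by (simp add: resolves_def)
  then show "y' = y" using resolved_simplex_unique y y' by blast
qed (use assms in blast)

lemma action_resolves:
  assumes f: "f \<in> Pointed m n" and x: "x \<in> Ob X m" "coherent {0<..m} z" "resolves m x z"
  shows "action m n f x \<in> Ob X n" "resolves n (action m n f x) (pushforward m f z)"
proof -
  obtain y where y: "y \<in> Ob X n" "resolves n y (pushforward m f z)"
    using resolved_simplex_exists [OF coherent_pushforward [OF f x(2)]] by blast
  from action_eqI [OF assms this] y
  show "action m n f x \<in> Ob X n" "resolves n (action m n f x) (pushforward m f z)" by simp_all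
qed

definition Gamma_functor :: "'a set_functor" where
  "Gamma_functor = \<lparr>Ob = Ob X, Ar = (\<lambda>m n. \<lambda>f\<in>Pointed m n. \<lambda>x\<in>Ob X m. action m n f x)\<rparr>"

lemma Gamma_set_Gamma_functor: "Gamma_set Gamma_functor"
  unfolding Gamma_set_def
proof (intro conjI allI ballI)
  show "Ar Gamma_functor m n \<in> Pointed m n \<rightarrow>\<^sub>E (Ob Gamma_functor m \<rightarrow>\<^sub>E Ob Gamma_functor n)" for m n
    using action_resolves(1) coherent_family_exists by (fastforce simp: Gamma_functor_def)
next
  fix n x assume "x \<in> Ob Gamma_functor n"
  then have x: "x \<in> Ob X n" by (simp add: Gamma_functor_def)
  then obtain z where z: "coherent {0<..n} z" "resolves n x z" using coherent_family_exists by blast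
  have "resolves n x (pushforward n (\<lambda>i\<in>{..n}. i) z)"
    unfolding resolves_def pushforward_def
  proof (intro allI impI)
    fix i j k assume "i \<le> j" "j \<le> k" "k \<le> n"
    then show "sub n [i, j, k] x = z (fiber n (\<lambda>i\<in>{..n}. i) {i<..j}) (fiber n (\<lambda>i\<in>{..n}. i) {j<..k})"
      by (subst (1 2) fiber_id) (auto simp: resolvesD [OF z(2)])
  qed
  then show "Ar Gamma_functor n n (\<lambda>i\<in>{..n}. i) x = x"
    using action_eqI [OF Pointed_id x z x] x by (simp add: Gamma_functor_def Pointed_id)
next
  fix m n p f g x assume fg: "f \<in> Pointed m n" "g \<in> Pointed n p" and "x \<in> Ob Gamma_functor m"
  then have x: "x \<in> Ob X m" by (simp add: Gamma_functor_def)
  then obtain z where z: "coherent {0<..m} z" "resolves m x z" using coherent_family_exists by blast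
  note y = action_resolves [OF fg(1) x z]
  note w = action_resolves [OF fg(2) y(1) coherent_pushforward [OF fg(1) z(1)] y(2)]
  have "pushforward n g (pushforward m f z) = pushforward m (compose {..m} g f) z"
    by (simp add: pushforward_def fiber_compose [OF fg(1)])
  then have "action m p (compose {..m} g f) x = action n p g (action m n f x)"
    using action_eqI [OF Pointed_compose [OF fg] x z w(1)] w(2) by simp
  then show "Ar Gamma_functor m p (compose {..m} g f) x =
      Ar Gamma_functor n p g (Ar Gamma_functor m n f x)"
    using fg x y(1) Pointed_compose [OF fg] by (simp add: Gamma_functor_def)
qed

text \<open>The triangle \<open>i, j, k\<close> of the image of \<open>x\<close> under \<open>f\<close> is the triangle \<open>f i, f j, f k\<close> of \<open>x\<close>, and
  \<open>fiber_Cut\<close> identifies its letters with preimages under \<open>Cut\<close>.\<close>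
lemma underlying_Gamma_functor: "underlying_simplicial_set Gamma_functor = X"
proof -
  have Ar_X: "Ar X n m \<in> Delta n m \<rightarrow>\<^sub>E (Ob X m \<rightarrow>\<^sub>E Ob X n)" for n m
    using simplicial by (simp add: simplicial_set_def)
  (* Maps outside Delta n m are sent to undefined by both sides. *)
  have "(\<lambda>f\<in>Delta n m. Ar Gamma_functor m n (Cut n m f)) = Ar X n m" for n m
  proof (rule ext)
    fix f
    show "(\<lambda>f\<in>Delta n m. Ar Gamma_functor m n (Cut n m f)) f = Ar X n m f"
    proof (cases "f \<in> Delta n m")
      case f: True
      have Af: "Ar X n m f \<in> Ob X m \<rightarrow>\<^sub>E Ob X n" using Ar_X f by (rule PiE_mem)
      have "action m n (Cut n m f) x = Ar X n m f x" if x: "x \<in> Ob X m" for x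
      proof -
        obtain z where z: "coherent {0<..m} z" "resolves m x z"
          using coherent_family_exists [OF x] by blast
        have bound: "f k \<le> m" "f i \<le> f j" if "i \<le> j" "j \<le> k" "k \<le> n" for i j k
          using f that by (auto simp: Delta_def mono_on_def Pi_def PiE_def)
        have "resolves n (Ar X n m f x) (pushforward m (Cut n m f) z)"
          unfolding resolves_def pushforward_def
        proof (intro allI impI)
          fix i j k assume ijk: "i \<le> j" "j \<le> k" "k \<le> n"
          then have "sub n [i, j, k] (Ar X n m f x) = sub m [f i, f j, f k] x"
            using sub_Ar [OF f _ x, of "[i, j, k]"] by simp
          also have "\<dots> = z {f i<..f j} {f j<..f k}"
            using resolvesD [OF z(2)] bound [of i j k] bound(2) [of j k k] ijk by simp
          finally show "sub n [i, j, k] (Ar X n m f x) =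
              z (fiber m (Cut n m f) {i<..j}) (fiber m (Cut n m f) {j<..k})"
            using fiber_Cut [OF f, of i j] fiber_Cut [OF f, of j k] ijk by simp
        qed
        then show ?thesis using action_eqI [OF Cut_in_Pointed x z Ar_closed [OF f x]] by simp
      qed
      then show ?thesis
        using f Af Cut_in_Pointed by (auto simp: Gamma_functor_def fun_eq_iff PiE_def extensional_def)
    next
      case False
      then show ?thesis using Ar_X [of n m] by (auto simp: PiE_def extensional_def)
    qed
  qed
  then show ?thesis by (simp add: underlying_simplicial_set_def Gamma_functor_def)
qed

lemma Gamma_functor_structure: "Gamma_functor \<in> Gamma_structures X"
  by (simp add: Gamma_structures_def Gamma_set_Gamma_functor underlying_Gamma_functor)

end

section \<open>The braiding of a \<Gamma>-structure\<close>

lemma Pointed_eqI: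
  assumes f: "f \<in> Pointed m n" and g: "g \<in> Pointed m n"
    and "\<And>i. 0 < i \<Longrightarrow> i \<le> n \<Longrightarrow> fiber m f {i} = fiber m g {i}"
  shows "f = g"
proof
  fix a
  show "f a = g a"
  proof (cases "a \<le> m")
    case True
    then have "f a = i \<longleftrightarrow> g a = i" if "0 < i" "i \<le> n" for i
      using assms(3) [OF that] by (auto simp: fiber_def)
    then show ?thesis
      using Pointed_bound [OF f True] Pointed_bound [OF g True] by (metis gr0I)
  next
    case False
    then show ?thesis using f g by (auto simp: Pointed_def PiE_def extensional_def)
  qed
qed

text \<open>The pointed maps that collect the letters in \<open>A\<close>, in \<open>B\<close> (and in \<open>C\<close>) into one letter each
  and omit all others.\<close>
definition indicator2 :: "nat \<Rightarrow> nat set \<Rightarrow> nat set \<Rightarrow> nat \<Rightarrow> nat" where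
  "indicator2 m A B = (\<lambda>i\<in>{..m}. if i \<in> A then 1 else if i \<in> B then 2 else 0)"

definition indicator3 :: "nat \<Rightarrow> nat set \<Rightarrow> nat set \<Rightarrow> nat set \<Rightarrow> nat \<Rightarrow> nat" where
  "indicator3 m A B C = (\<lambda>i\<in>{..m}. if i \<in> A then 1 else if i \<in> B then 2 else if i \<in> C then 3 else 0)"

lemma indicator2_in_Pointed: "A \<union> B \<subseteq> {0<..m} \<Longrightarrow> indicator2 m A B \<in> Pointed m 2"
  by (auto simp: Pointed_def indicator2_def)

lemma indicator3_in_Pointed: "A \<union> B \<union> C \<subseteq> {0<..m} \<Longrightarrow> indicator3 m A B C \<in> Pointed m 3"
  by (auto simp: Pointed_def indicator3_def)

lemma fiber_indicator2:
  assumes "A \<union> B \<subseteq> {0<..m}" "A \<inter> B = {}"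
  shows "fiber m (indicator2 m A B) {1} = A" "fiber m (indicator2 m A B) {2} = B"
  using assms by (auto simp: fiber_def indicator2_def)

lemma fiber_indicator3:
  assumes "A \<union> B \<union> C \<subseteq> {0<..m}" "A \<inter> B = {}" "A \<inter> C = {}" "B \<inter> C = {}"
  shows "fiber m (indicator3 m A B C) {0<..1} = A" "fiber m (indicator3 m A B C) {1<..2} = B"
    "fiber m (indicator3 m A B C) {2<..3} = C" "fiber m (indicator3 m A B C) {0<..2} = A \<union> B"
    "fiber m (indicator3 m A B C) {1<..3} = B \<union> C"
  using assms by (auto simp: fiber_def indicator3_def)

locale Gamma_structure_on = two_Segal_set +
  fixes Y :: "'a set_functor"
  assumes Y: "Y \<in> Gamma_structures X"
begin

lemma Ob_Y: "Ob Y = Ob X" and Ar_X: "f \<in> Delta n m \<Longrightarrow> Ar X n m f = Ar Y m n (Cut n m f)"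
proof -
  have eq: "underlying_simplicial_set Y = X" using Y by (simp add: Gamma_structures_def)
  show "Ob Y = Ob X" unfolding eq [symmetric] by (simp add: underlying_simplicial_set_def)
  show "f \<in> Delta n m \<Longrightarrow> Ar X n m f = Ar Y m n (Cut n m f)"
    unfolding eq [symmetric] by (simp add: underlying_simplicial_set_def)
qed

lemma Gamma_set_Y: "Gamma_set Y"
  using Y by (simp add: Gamma_structures_def)

lemma Ar_Y_extensional: "Ar Y m n \<in> Pointed m n \<rightarrow>\<^sub>E (Ob X m \<rightarrow>\<^sub>E Ob X n)"
  using Gamma_set_Y unfolding Gamma_set_def Ob_Y by simp

lemma Ar_Y_closed: "f \<in> Pointed m n \<Longrightarrow> x \<in> Ob X m \<Longrightarrow> Ar Y m n f x \<in> Ob X n"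
  using Ar_Y_extensional by (blast dest: PiE_mem)

lemma Ar_Y_id: "x \<in> Ob X n \<Longrightarrow> Ar Y n n (\<lambda>i\<in>{..n}. i) x = x"
  using Gamma_set_Y unfolding Gamma_set_def Ob_Y by simp

lemma Ar_Y_compose:
  "f \<in> Pointed m n \<Longrightarrow> g \<in> Pointed n p \<Longrightarrow> x \<in> Ob X m \<Longrightarrow>
     Ar Y n p g (Ar Y m n f x) = Ar Y m p (compose {..m} g f) x"
  using Gamma_set_Y unfolding Gamma_set_def Ob_Y by simp

definition block_triangle :: "nat \<Rightarrow> 'a \<Rightarrow> nat set \<Rightarrow> nat set \<Rightarrow> 'a" where
  "block_triangle m x A B = Ar Y m 2 (indicator2 m A B) x"

lemma block_triangle_closed:
  "A \<union> B \<subseteq> {0<..m} \<Longrightarrow> x \<in> Ob X m \<Longrightarrow> block_triangle m x A B \<in> Ob X 2"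
  by (simp add: block_triangle_def Ar_Y_closed indicator2_in_Pointed)

text \<open>Both sides are induced by pointed maps to \<open>\<langle>2\<rangle>\<close>, and these have the same preimages of 1
  and of 2. The formula reduces questions about faces to computations with sets of letters.\<close>
lemma sub_Ar_Y:
  assumes f: "f \<in> Pointed m n" and x: "x \<in> Ob X m" and ijk: "i \<le> j" "j \<le> k" "k \<le> n"
  shows "sub n [i, j, k] (Ar Y m n f x) = block_triangle m x (fiber m f {i<..j}) (fiber m f {j<..k})"
proof -
  let ?v = "vertex_map [i, j, k]"
  have v: "?v \<in> Delta 2 n" by (rule vertex_map_in_Delta) (use ijk in simp_all)
  have nth: "?v 0 = i" "?v 1 = j" "?v 2 = k" by (simp_all add: vertex_map_def)
  have disj: "fiber m f {i<..j} \<inter> fiber m f {j<..k} = {}" by (auto simp: fiber_def)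
  have sub: "fiber m f {i<..j} \<union> fiber m f {j<..k} \<subseteq> {0<..m}"
    using fiber_subset [OF f] by simp
  have "compose {..m} (Cut 2 n ?v) f = indicator2 m (fiber m f {i<..j}) (fiber m f {j<..k})"
  proof (rule Pointed_eqI)
    fix l :: nat assume "0 < l" "l \<le> 2"
    then have "l = 1 \<and> {l} = {0<..1} \<or> l = 2 \<and> {l} = {1<..2}" by auto
    then show "fiber m (compose {..m} (Cut 2 n ?v) f) {l}
        = fiber m (indicator2 m (fiber m f {i<..j}) (fiber m f {j<..k})) {l}"
      using fiber_Cut [OF v, of 0 1] fiber_Cut [OF v, of 1 2] fiber_indicator2 [OF sub disj] nth
      by (auto simp: fiber_compose [OF f])
  qed (use Pointed_compose [OF f Cut_in_Pointed] indicator2_in_Pointed [OF sub] in auto)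
  then show ?thesis
    using Ar_Y_compose [OF f Cut_in_Pointed x] Ar_X [OF v]
    by (simp add: sub_simplex_def block_triangle_def numeral_2_eq_2)
qed

lemma sub_block_triangle:
  assumes x: "x \<in> Ob X m" and ijk: "i \<le> j" "j \<le> k" "k \<le> m"
  shows "sub m [i, j, k] x = block_triangle m x {i<..j} {j<..k}"
proof -
  have "fiber m (\<lambda>i\<in>{..m}. i) {i<..j} = {i<..j}" "fiber m (\<lambda>i\<in>{..m}. i) {j<..k} = {j<..k}"
    using ijk by (intro fiber_id; force)+
  then show ?thesis
    using sub_Ar_Y [OF Pointed_id x ijk] by (simp add: Ar_Y_id [OF x])
qed

text \<open>The tetrahedron is the image of \<open>x\<close> in \<open>Ob X 3\<close> under the pointed map that collects \<open>A\<close>, \<open>B\<close>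
  and \<open>C\<close> into one letter each.\<close>
lemma block_triangle_tetra:
  assumes x: "x \<in> Ob X m" and ABC: "A \<union> B \<union> C \<subseteq> {0<..m}" "A \<inter> B = {}" "A \<inter> C = {}" "B \<inter> C = {}"
  shows "tetra (block_triangle m x A B) (block_triangle m x (A \<union> B) C)
    (block_triangle m x A (B \<union> C)) (block_triangle m x B C)"
proof -
  let ?f = "indicator3 m A B C"
  note f = indicator3_in_Pointed [OF ABC(1)]
  note s = sub_Ar_Y [OF f x]
  show ?thesis
    using tetra_sub [OF Ar_Y_closed [OF f x], of 0 1 2 3]
      s [of 0 1 2] s [of 0 2 3] s [of 0 1 3] s [of 1 2 3] fiber_indicator3 [OF ABC]
    by simp
qed

text \<open>The pointed map in question is the transposition of \<open>\<langle>2\<rangle>\<close>.\<close>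
definition swap :: "'a \<Rightarrow> 'a" where
  "swap = Ar Y 2 2 (indicator2 2 {2} {1})"

lemma swap_eq: "swap \<xi> = block_triangle 2 \<xi> {2} {1}"
  by (simp add: swap_def block_triangle_def)

lemma swap_closed: "\<xi> \<in> Ob X 2 \<Longrightarrow> swap \<xi> \<in> Ob X 2"
  by (simp add: swap_eq block_triangle_closed)

lemma block_triangle_swap:
  assumes x: "x \<in> Ob X m" and AB: "A \<union> B \<subseteq> {0<..m}" "A \<inter> B = {}"
  shows "block_triangle m x B A = swap (block_triangle m x A B)"
proof -
  have AB': "B \<union> A \<subseteq> {0<..m}" "B \<inter> A = {}" using AB by auto
  have t: "indicator2 2 {2} {1} \<in> Pointed 2 2" by (rule indicator2_in_Pointed) auto
  have "compose {..m} (indicator2 2 {2} {1}) (indicator2 m A B) = indicator2 m B A"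
  proof (rule Pointed_eqI)
    fix l :: nat assume "0 < l" "l \<le> 2"
    then have "l = 1 \<or> l = 2" by auto
    then show "fiber m (compose {..m} (indicator2 2 {2} {1}) (indicator2 m A B)) {l}
        = fiber m (indicator2 m B A) {l}"
      using fiber_indicator2 [of "{2}" "{1}" 2] fiber_indicator2 [OF AB] fiber_indicator2 [OF AB']
      by (auto simp: fiber_compose [OF indicator2_in_Pointed [OF AB(1)]])
  qed (use Pointed_compose [OF indicator2_in_Pointed [OF AB(1)] t]
      indicator2_in_Pointed [OF AB'(1)] in auto)
  then show ?thesis
    using Ar_Y_compose [OF indicator2_in_Pointed [OF AB(1)] t x]
    by (simp add: swap_def block_triangle_def)
qed

text \<open>The pointed map that omits all letters factors through \<open>\<langle>0\<rangle>\<close>.\<close>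
lemma block_triangle_empty:
  assumes x: "x \<in> Ob X m"
  shows "\<exists>v \<in> Ob X 0. sub 2 [0, 1] (block_triangle m x {} {}) = sub 0 [0, 0] v"
proof -
  have f: "(\<lambda>i\<in>{..m}. 0) \<in> Pointed m 0" by (auto simp: Pointed_def)
  let ?v = "Ar Y m 0 (\<lambda>i\<in>{..m}. 0) x"
  have v: "?v \<in> Ob X 0" by (rule Ar_Y_closed [OF f x])
  have "sub 0 [0, 0, 0] ?v = block_triangle m x {} {}"
    using sub_Ar_Y [OF f x, of 0 0 0] by simp
  from this [symmetric] v show ?thesis by (intro bexI [of _ ?v]) simp_all
qed

text \<open>An edge is the first edge of the degenerate triangle on it, and degenerate triangles are
  covered by the formula for block triangles.\<close>
lemma swap_edges:
  assumes \<xi>: "\<xi> \<in> Ob X 2"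
  shows "sub 2 [0, 1] (swap \<xi>) = sub 2 [1, 2] \<xi>" "sub 2 [1, 2] (swap \<xi>) = sub 2 [0, 1] \<xi>"
    "sub 2 [0, 2] (swap \<xi>) = sub 2 [0, 2] \<xi>"
proof -
  have t: "indicator2 2 {2} {1} \<in> Pointed 2 2" by (rule indicator2_in_Pointed) auto
  have int: "{0<..1::nat} = {1}" "{1<..2::nat} = {2}" "{0<..2::nat} = {1, 2}" by auto
  have fib: "fiber 2 (indicator2 2 {2} {1}) {1} = {2}" "fiber 2 (indicator2 2 {2} {1}) {2} = {1}"
    "fiber 2 (indicator2 2 {2} {1}) {1, 2} = {1, 2}"
    by (auto simp: fiber_def indicator2_def)
  have "sub 2 [i, j, j] (swap \<xi>) = sub 2 [k, l, l] \<xi>"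
    if "fiber 2 (indicator2 2 {2} {1}) {i<..j} = {k<..l}" "i \<le> j" "j \<le> 2" "k \<le> l" "l \<le> 2" for i j k l
    using sub_Ar_Y [OF t \<xi>, of i j j] sub_block_triangle [OF \<xi>, of k l l] that
    by (simp add: swap_def)
  then have *: "sub 2 [0, 1] (sub 2 [i, j, j] (swap \<xi>)) = sub 2 [0, 1] (sub 2 [k, l, l] \<xi>)"
    if "fiber 2 (indicator2 2 {2} {1}) {i<..j} = {k<..l}" "i \<le> j" "j \<le> 2" "k \<le> l" "l \<le> 2" for i j k l
    using that by simp
  show "sub 2 [0, 1] (swap \<xi>) = sub 2 [1, 2] \<xi>"
    using *[of 0 1 1 2] \<xi> swap_closed [OF \<xi>] int fib by simp
  show "sub 2 [1, 2] (swap \<xi>) = sub 2 [0, 1] \<xi>"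
    using *[of 1 2 0 1] \<xi> swap_closed [OF \<xi>] int fib by simp
  show "sub 2 [0, 2] (swap \<xi>) = sub 2 [0, 2] \<xi>"
    using *[of 0 2 0 2] \<xi> swap_closed [OF \<xi>] int fib by simp
qed

sublocale braided_two_Segal_set X swap
proof
  fix \<xi> assume \<xi>: "\<xi> \<in> Ob X 2"
  show "swap \<xi> \<in> Ob X 2" by (rule swap_closed [OF \<xi>])
  show "sub 2 [0, 1] (swap \<xi>) = sub 2 [1, 2] \<xi>" "sub 2 [1, 2] (swap \<xi>) = sub 2 [0, 1] \<xi>"
    "sub 2 [0, 2] (swap \<xi>) = sub 2 [0, 2] \<xi>"
    using swap_edges [OF \<xi>] .
  have int: "{0<..Suc 0} = {1}" "{Suc 0<..2} = {2}" by auto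
  have "\<xi> = block_triangle 2 \<xi> {1} {2}"
    using sub_block_triangle [OF \<xi>, of 0 1 2] \<xi> int by simp
  then show "swap (swap \<xi>) = \<xi>"
    using block_triangle_swap [OF \<xi>, of "{2}" "{1}"] by (simp add: swap_eq [of \<xi>])
next
  fix p q r s r' s' assume pqrs: "tetra p q r s" and r's': "tetra (swap p) q r' s'"
  from pqrs obtain \<psi> where \<psi>: "\<psi> \<in> Ob X 3" and faces: "sub 3 [0, 1, 2] \<psi> = p"
    "sub 3 [0, 2, 3] \<psi> = q" "sub 3 [0, 1, 3] \<psi> = r" "sub 3 [1, 2, 3] \<psi> = s"
    by (auto simp: tetra_def)
  let ?z = "block_triangle 3 \<psi>"
  have int: "{0<..1::nat} = {1}" "{1<..2::nat} = {2}" "{2<..3::nat} = {3}" "{0<..2::nat} = {1, 2}"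
    "{1<..3::nat} = {2, 3}" by auto
  note s = sub_block_triangle [OF \<psi>]
  have z: "p = ?z {1} {2}" "q = ?z {1, 2} {3}" "r = ?z {1} {2, 3}" "s = ?z {2} {3}"
    using s [of 0 1 2] s [of 0 2 3] s [of 0 1 3] s [of 1 2 3] faces unfolding int by auto
  have sw: "?z {2} {1} = swap p" "?z {2, 3} {1} = swap r" "?z {3} {1} = swap (?z {1} {3})"
    unfolding z by (rule block_triangle_swap [OF \<psi>]; auto)+
  have "tetra (swap p) q (?z {2} {1, 3}) (?z {1} {3})"
    using block_triangle_tetra [OF \<psi>, of "{2}" "{1}" "{3}"] sw(1) z(2) by (simp add: insert_commute)
  then have "r' = ?z {2} {1, 3}" "s' = ?z {1} {3}"
    using tetra_right_unique [OF _ r's'] by blast+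
  then show "tetra s (swap r) r' (swap s')"
    using block_triangle_tetra [OF \<psi>, of "{2}" "{3}" "{1}"] sw z(4) by (simp add: insert_commute)
qed

lemma coherent_block_triangle:
  assumes x: "x \<in> Ob X m"
  shows "coherent {0<..m} (block_triangle m x)" "resolves m x (block_triangle m x)"
  unfolding coherent_def resolves_def
  by (intro conjI allI impI block_triangle_closed block_triangle_swap block_triangle_tetra
      block_triangle_empty sub_block_triangle x; assumption)+

text \<open>By \<open>sub_Ar_Y\<close> the triangles of \<open>Ar Y m n f x\<close> are the pushforward of the coherent family of
  block triangles of \<open>x\<close>, and this characterizes the constructed action.\<close>
lemma Ar_Y_eq_action:
  assumes f: "f \<in> Pointed m n" and x: "x \<in> Ob X m"
  shows "Ar Y m n f x = action m n f x"
proof -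
  have "resolves n (Ar Y m n f x) (pushforward m f (block_triangle m x))"
    unfolding resolves_def pushforward_def using sub_Ar_Y [OF f x] by blast
  then show ?thesis
    using action_eqI [OF f x coherent_block_triangle [OF x] Ar_Y_closed [OF f x]] by simp
qed

lemma Gamma_functor_eq: "Gamma_functor = Y"
proof -
  have "(\<lambda>f\<in>Pointed m n. \<lambda>x\<in>Ob X m. action m n f x) = Ar Y m n" for m n
  proof (rule ext)
    fix f
    show "(\<lambda>f\<in>Pointed m n. \<lambda>x\<in>Ob X m. action m n f x) f = Ar Y m n f"
    proof (cases "f \<in> Pointed m n")
      case True
      then have "Ar Y m n f \<in> extensional (Ob X m)"
        using Ar_Y_extensional [of m n] by (auto simp: PiE_def)
      then show ?thesis
        using True Ar_Y_eq_action [OF True] by (auto simp: extensional_def)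
    qed (use Ar_Y_extensional [of m n] in \<open>auto simp: PiE_def extensional_def\<close>)
  qed
  then show ?thesis by (simp add: Gamma_functor_def Ob_Y)
qed

end

context braided_two_Segal_set begin

lemma swap_Gamma_functor:
  assumes \<xi>: "\<xi> \<in> Ob X 2"
  shows "Gamma_structure_on.swap Gamma_functor \<xi> = \<tau> \<xi>"
proof -
  interpret G: Gamma_structure_on X Gamma_functor
    by unfold_locales (rule Gamma_functor_structure)
  have t: "indicator2 2 {2} {1} \<in> Pointed 2 2" by (rule indicator2_in_Pointed) auto
  obtain z where z: "coherent {0<..2} z" "resolves 2 \<xi> z"
    using coherent_family_exists [OF \<xi>] by blast
  have int: "{0<..Suc 0} = {1}" "{Suc 0<..2} = {2}" by auto
  have fib: "fiber 2 (indicator2 2 {2} {Suc 0}) {Suc 0} = {2}"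
    "fiber 2 (indicator2 2 {2} {Suc 0}) {2} = {1}"
    by (auto simp: fiber_def indicator2_def)
  have "\<xi> = z {1} {2}" using resolvesD [OF z(2), of 0 1 2] int \<xi> by simp
  have "G.swap \<xi> = action 2 2 (indicator2 2 {2} {1}) \<xi>"
    unfolding G.swap_def using t \<xi> by (simp add: Gamma_functor_def)
  also have "\<dots> = z {2} {1}"
    using resolvesD [OF action_resolves(2) [OF t \<xi> z], of 0 1 2] action_resolves(1) [OF t \<xi> z] int fib
    by (simp add: pushforward_def)
  also have "\<dots> = \<tau> \<xi>"
    unfolding \<open>\<xi> = z {1} {2}\<close> by (rule coherentD(2) [OF z(1)]) auto
  finally show ?thesis .
qed

end

section \<open>Commutative structures as braidings\<close>

lemma braid_syl_inv_eq:
  assumes "a \<in> A" "b \<in> B"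
  shows "braid_syl_inv A B (a, b) = ((a, b), (b, a))"
proof -
  let ?M = "apex (braid B A \<circ>\<^sub>s braid A B)"
  have M: "?M = {((a, b), (b, a)) | a b. a \<in> A \<and> b \<in> B}"
    by (auto simp: span_comp_def braid_def)
  have "inj_on braid_syl ?M" by (auto simp: M inj_on_def braid_syl_def)
  moreover have "((a, b), (b, a)) \<in> ?M" using assms by (auto simp: M)
  ultimately have "inv_into ?M braid_syl (braid_syl ((a, b), (b, a))) = ((a, b), (b, a))"
    by (rule inv_into_f_f)
  then show ?thesis by (simp add: braid_syl_inv_def braid_syl_def)
qed

context two_Segal_set begin

abbreviation "P \<equiv> Segal_pseudomonoid X"

text \<open>The apex of \<open>\<mu> \<circ> \<rho>\<close> consists of triples \<open>((a, b), \<xi>)\<close> in which \<open>(b, a)\<close> is the pair of factors of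
  \<open>\<xi>\<close>. The left legs force the first component of a 2-morphism from \<open>\<mu>\<close> to be the pair of factors of its
  argument, so only the component \<open>\<tau>\<close> is free.\<close>
definition over_edges :: "('a \<Rightarrow> 'a) \<Rightarrow> 'a \<Rightarrow> ('a \<times> 'a) \<times> 'a" where
  "over_edges \<tau> = (\<lambda>\<xi>\<in>Ob X 2. ((sub 2 [0, 1] \<xi>, sub 2 [1, 2] \<xi>), \<tau> \<xi>))"

definition swaps_edges :: "('a \<Rightarrow> 'a) \<Rightarrow> bool" where
  "swaps_edges \<tau> \<longleftrightarrow> (\<forall>\<xi> \<in> Ob X 2. \<tau> \<xi> \<in> Ob X 2 \<and> sub 2 [0, 1] (\<tau> \<xi>) = sub 2 [1, 2] \<xi> \<and>
     sub 2 [1, 2] (\<tau> \<xi>) = sub 2 [0, 1] \<xi> \<and> sub 2 [0, 2] (\<tau> \<xi>) = sub 2 [0, 2] \<xi>)"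

lemma swaps_edgesD:
  assumes "swaps_edges \<tau>" "\<xi> \<in> Ob X 2"
  shows "\<tau> \<xi> \<in> Ob X 2" "sub 2 [0, 1] (\<tau> \<xi>) = sub 2 [1, 2] \<xi>"
    "sub 2 [1, 2] (\<tau> \<xi>) = sub 2 [0, 1] \<xi>" "sub 2 [0, 2] (\<tau> \<xi>) = sub 2 [0, 2] \<xi>"
  using assms by (auto simp: swaps_edges_def)

lemma apex_mult_braid:
  "((a, b), \<xi>) \<in> apex (Segal_mult X \<circ>\<^sub>s braid (Ob X 1) (Ob X 1)) \<longleftrightarrow>
     \<xi> \<in> Ob X 2 \<and> b = sub 2 [0, 1] \<xi> \<and> a = sub 2 [1, 2] \<xi>"
  by (auto simp: span_comp_def braid_def Segal_mult_def face_eq_sub)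

lemma two_morphism_iff:
  "two_morphism (Segal_mult X) (Segal_mult X \<circ>\<^sub>s braid (Ob X 1) (Ob X 1)) \<gamma> \<longleftrightarrow>
     (\<exists>\<tau> \<in> Ob X 2 \<rightarrow>\<^sub>E Ob X 2. swaps_edges \<tau> \<and> \<gamma> = over_edges \<tau>)"
  (is "?L \<longleftrightarrow> ?R")
proof
  let ?S = "Segal_mult X \<circ>\<^sub>s braid (Ob X 1) (Ob X 1)"
  assume ?L
  then have \<gamma>: "\<gamma> \<in> Ob X 2 \<rightarrow>\<^sub>E apex ?S"
    "\<And>\<xi>. \<xi> \<in> Ob X 2 \<Longrightarrow> lleg ?S (\<gamma> \<xi>) = (sub 2 [0, 1] \<xi>, sub 2 [1, 2] \<xi>) \<and> rleg ?S (\<gamma> \<xi>) = sub 2 [0, 2] \<xi>"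
    by (auto simp: two_morphism_def Segal_mult_def face_eq_sub)
  define \<tau> where "\<tau> = (\<lambda>\<xi>\<in>Ob X 2. snd (\<gamma> \<xi>))"
  have eq: "\<gamma> \<xi> = ((sub 2 [0, 1] \<xi>, sub 2 [1, 2] \<xi>), \<tau> \<xi>)" "sub 2 [0, 2] (\<tau> \<xi>) = sub 2 [0, 2] \<xi>"
    "\<gamma> \<xi> \<in> apex ?S" if "\<xi> \<in> Ob X 2" for \<xi>
  proof -
    show mem: "\<gamma> \<xi> \<in> apex ?S" using \<gamma>(1) that by (rule PiE_mem)
    show "\<gamma> \<xi> = ((sub 2 [0, 1] \<xi>, sub 2 [1, 2] \<xi>), \<tau> \<xi>)" "sub 2 [0, 2] (\<tau> \<xi>) = sub 2 [0, 2] \<xi>"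
      using \<gamma>(2) [OF that] that
      by (auto simp: \<tau>_def span_comp_def braid_def Segal_mult_def face_eq_sub split: prod.splits)
  qed
  have "swaps_edges \<tau>"
    unfolding swaps_edges_def
  proof (intro ballI)
    fix \<xi> assume \<xi>: "\<xi> \<in> Ob X 2"
    from eq(3) [OF this] eq(2) [OF this]
    show "\<tau> \<xi> \<in> Ob X 2 \<and> sub 2 [0, 1] (\<tau> \<xi>) = sub 2 [1, 2] \<xi> \<and>
        sub 2 [1, 2] (\<tau> \<xi>) = sub 2 [0, 1] \<xi> \<and> sub 2 [0, 2] (\<tau> \<xi>) = sub 2 [0, 2] \<xi>"
      unfolding eq(1) [OF \<xi>] apex_mult_braid by simp
  qed
  moreover have "\<gamma> = over_edges \<tau>"
    using \<gamma>(1) eq(1) by (fastforce simp: over_edges_def PiE_def extensional_def fun_eq_iff)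
  moreover have "\<tau> \<in> Ob X 2 \<rightarrow>\<^sub>E Ob X 2"
    using swaps_edgesD(1) [OF \<open>swaps_edges \<tau>\<close>] by (auto simp: \<tau>_def)
  ultimately show ?R by blast
next
  assume ?R
  then obtain \<tau> where \<tau>: "swaps_edges \<tau>" "\<gamma> = over_edges \<tau>" by blast
  let ?S = "Segal_mult X \<circ>\<^sub>s braid (Ob X 1) (Ob X 1)"
  have apex: "apex (Segal_mult X) = Ob X 2" by (simp add: Segal_mult_def)
  have mem: "over_edges \<tau> \<xi> \<in> apex ?S" if "\<xi> \<in> Ob X 2" for \<xi>
    using that swaps_edgesD [OF \<tau>(1) that] by (simp only: over_edges_def restrict_apply' apex_mult_braid)
  have "over_edges \<tau> \<in> Ob X 2 \<rightarrow>\<^sub>E apex ?S"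
  proof (rule PiE_I)
    show "over_edges \<tau> \<xi> = undefined" if "\<xi> \<notin> Ob X 2" for \<xi>
      using that by (simp add: over_edges_def)
  qed (rule mem)
  then show ?L
    unfolding two_morphism_def \<tau>(2) apex using swaps_edgesD(4) [OF \<tau>(1)]
    by (simp add: over_edges_def Segal_mult_def span_comp_def braid_def face_eq_sub)
qed

lemma symmetry_axiom_iff:
  assumes \<tau>: "swaps_edges \<tau>"
  shows "symmetry_axiom P (over_edges \<tau>) \<longleftrightarrow> (\<forall>\<xi> \<in> Ob X 2. \<tau> (\<tau> \<xi>) = \<xi>)"
proof -
  have "(span_assoc \<circ> whisker_right (over_edges \<tau>) \<circ> over_edges \<tau>) \<xi> =
      (((sub 2 [0, 1] \<xi>, sub 2 [1, 2] \<xi>), (sub 2 [1, 2] \<xi>, sub 2 [0, 1] \<xi>)), \<tau> (\<tau> \<xi>))"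
    "(whisker_left (braid_syl_inv (pobj P) (pobj P)) \<circ> span_unit_inv (pmult P)) \<xi> =
      (((sub 2 [0, 1] \<xi>, sub 2 [1, 2] \<xi>), (sub 2 [1, 2] \<xi>, sub 2 [0, 1] \<xi>)), \<xi>)" if "\<xi> \<in> Ob X 2" for \<xi>
    using that swaps_edgesD [OF \<tau> that]
    by (simp_all add: over_edges_def whisker_left_def whisker_right_def span_assoc_def span_unit_inv_def
        Segal_pseudomonoid_def Segal_mult_def face_eq_sub braid_syl_inv_eq)
  then show ?thesis
    by (simp add: symmetry_axiom_def Segal_pseudomonoid_def Segal_mult_def)
qed

lemma Segal_assoc_eq:
  assumes "tetra p q r s"
  shows "Segal_assoc X ((p, a), q) = ((sub 2 [0, 1] r, s), r)"
proof -
  obtain \<psi> where \<psi>: "\<psi> \<in> Ob X 3" "sub 3 [0, 1, 2] \<psi> = p" "sub 3 [0, 2, 3] \<psi> = q"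
    "sub 3 [0, 1, 3] \<psi> = r" "sub 3 [1, 2, 3] \<psi> = s"
    using assms by (auto simp: tetra_def)
  have "inj_on (T13 X) (Ob X 3)"
    by (auto simp: inj_on_def T13_def face_eq_sub intro: eq_by_T13)
  moreover have "T13 X \<psi> = (p, q)" using \<psi> by (simp add: T13_def face_eq_sub)
  ultimately have "inv_into (Ob X 3) (T13 X) (p, q) = \<psi>"
    using \<psi>(1) inv_into_f_f by metis
  then show ?thesis
    using \<psi> by (simp add: Segal_assoc_def T02_def face_eq_sub)
qed

text \<open>Both composites of the hexagon are followed on the element given by a tetrahedron for
  \<open>abc\<close>. The left legs contribute the letters, which agree for both; what is left to compare are the
  pairs of triangles for \<open>bca\<close>.\<close>
lemma hexagon_fst_eq:
  assumes \<tau>: "swaps_edges \<tau>" and pqrs: "tetra p q r s" and hex: "tetra s (\<tau> r) r2 s2"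
  shows "hexagon_fst P (over_edges \<tau>) ((p, sub 2 [1, 2] q), q) =
    ((sub 2 [0, 1] p, sub 2 [1, 2] p, sub 2 [1, 2] q), ((sub 2 [0, 1] r2, s2), r2))"
  using tetra_closed [OF pqrs] tetra_edges [OF pqrs]
  by (simp add: hexagon_fst_def Segal_pseudomonoid_def Segal_assoc_eq [OF pqrs] Segal_assoc_eq [OF hex]
      whisker_left_def whisker_right_def span_assoc_def span_assoc_inv_def over_edges_def braid_nat_def
      id_span_def Segal_mult_def face_eq_sub)

lemma hexagon_snd_eq:
  assumes \<tau>: "swaps_edges \<tau>" and pq: "p \<in> Ob X 2" and hex: "tetra (\<tau> p) q r' s'"
  shows "hexagon_snd P (over_edges \<tau>) ((p, sub 2 [1, 2] q), q) =
    ((sub 2 [0, 1] p, sub 2 [1, 2] p, sub 2 [1, 2] q), ((sub 2 [0, 1] r', \<tau> s'), r'))"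
  using tetra_closed [OF hex] pq
  by (simp add: hexagon_snd_def Segal_pseudomonoid_def Segal_assoc_eq [OF hex]
      whisker_left_def whisker_right_def span_assoc_def span_assoc_inv_def over_edges_def braid_hex_def)

lemma hexagon_axiom_iff:
  assumes \<tau>: "swaps_edges \<tau>"
  shows "hexagon_axiom P (over_edges \<tau>) \<longleftrightarrow>
    (\<forall>p q r s r' s'. tetra p q r s \<longrightarrow> tetra (\<tau> p) q r' s' \<longrightarrow> tetra s (\<tau> r) r' (\<tau> s'))"
  (is "?L \<longleftrightarrow> ?R")
proof -
  let ?A = "apex (pmult P \<circ>\<^sub>s rassoc_source (pmult P \<times>\<^sub>s id_span (pobj P)))"
  have apex: "?A = {((p, sub 2 [1, 2] q), q) | p q.
      p \<in> Ob X 2 \<and> q \<in> Ob X 2 \<and> sub 2 [0, 2] p = sub 2 [0, 1] q}"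
    by (auto simp: Segal_pseudomonoid_def Segal_mult_def rassoc_source_def span_comp_def span_prod_def
        id_span_def face_eq_sub)
  have composable: "sub 2 [0, 2] s = sub 2 [0, 1] (\<tau> r)" if "tetra p q r s" for p q r s
    using tetra_edges [OF that] swaps_edgesD [OF \<tau> tetra_closed(3) [OF that]] by simp
  show ?thesis
  proof
    assume ?L
    show ?R
    proof (intro allI impI)
      fix p q r s r' s' assume t: "tetra p q r s" "tetra (\<tau> p) q r' s'"
      note c = tetra_closed [OF t(1)]
      obtain r2 s2 where u: "tetra s (\<tau> r) r2 s2"
        using tetra_exists [OF c(4) swaps_edgesD(1) [OF \<tau> c(3)] composable [OF t(1)]] .
      have "((p, sub 2 [1, 2] q), q) \<in> ?A"
        using c tetra_edges [OF t(1)] unfolding apex by blast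
      then have "hexagon_fst P (over_edges \<tau>) ((p, sub 2 [1, 2] q), q)
          = hexagon_snd P (over_edges \<tau>) ((p, sub 2 [1, 2] q), q)"
        using \<open>?L\<close> unfolding hexagon_axiom_def by blast
      then show "tetra s (\<tau> r) r' (\<tau> s')"
        using u hexagon_fst_eq [OF \<tau> t(1) u] hexagon_snd_eq [OF \<tau> c(1) t(2)] by simp
    qed
  next
    assume ?R
    show ?L
      unfolding hexagon_axiom_def
    proof
      fix x assume "x \<in> ?A"
      then obtain p q where pq: "x = ((p, sub 2 [1, 2] q), q)" "p \<in> Ob X 2" "q \<in> Ob X 2"
        "sub 2 [0, 2] p = sub 2 [0, 1] q" unfolding apex by blast
      obtain r s where t: "tetra p q r s" using tetra_exists [OF pq(2-4)] .
      obtain r' s' where t': "tetra (\<tau> p) q r' s'"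
        using tetra_exists [of "\<tau> p" q] pq swaps_edgesD [OF \<tau> pq(2)] by metis
      from \<open>?R\<close> t t' have "tetra s (\<tau> r) r' (\<tau> s')" by blast
      from hexagon_fst_eq [OF \<tau> t this] hexagon_snd_eq [OF \<tau> pq(2) t']
      show "hexagon_fst P (over_edges \<tau>) x = hexagon_snd P (over_edges \<tau>) x"
        unfolding pq(1) by simp
    qed
  qed
qed

definition braidings :: "('a \<Rightarrow> 'a) set" where
  "braidings = {\<tau> \<in> Ob X 2 \<rightarrow>\<^sub>E Ob X 2. braided_two_Segal_set X \<tau>}"

lemma braided_iff:
  "braided_two_Segal_set X \<tau> \<longleftrightarrow> swaps_edges \<tau> \<and> (\<forall>\<xi> \<in> Ob X 2. \<tau> (\<tau> \<xi>) = \<xi>) \<and>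
    (\<forall>p q r s r' s'. tetra p q r s \<longrightarrow> tetra (\<tau> p) q r' s' \<longrightarrow> tetra s (\<tau> r) r' (\<tau> s'))"
  unfolding braided_two_Segal_set_def braided_two_Segal_set_axioms_def swaps_edges_def
  using two_Segal_set_axioms by blast

text \<open>An inverse is \<open>((a, b), \<xi>) \<mapsto> \<tau> \<xi>\<close>, because \<open>\<tau>\<close> is an involution.\<close>
lemma over_edges_invertible:
  assumes \<tau>: "\<tau> \<in> Ob X 2 \<rightarrow>\<^sub>E Ob X 2" "swaps_edges \<tau>" "\<forall>\<xi> \<in> Ob X 2. \<tau> (\<tau> \<xi>) = \<xi>"
  shows "invertible_two_morphism (Segal_mult X) (Segal_mult X \<circ>\<^sub>s braid (Ob X 1) (Ob X 1)) (over_edges \<tau>)"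
proof -
  let ?S = "Segal_mult X \<circ>\<^sub>s braid (Ob X 1) (Ob X 1)"
  define k where "k = (\<lambda>y\<in>apex ?S. \<tau> (snd y))"
  have y: "\<exists>\<xi> \<in> Ob X 2. y = ((sub 2 [1, 2] \<xi>, sub 2 [0, 1] \<xi>), \<xi>)" if "y \<in> apex ?S" for y
    using that by (cases y) (use apex_mult_braid in fastforce)
  have mem: "((sub 2 [1, 2] \<xi>, sub 2 [0, 1] \<xi>), \<xi>) \<in> apex ?S" if "\<xi> \<in> Ob X 2" for \<xi>
    using that apex_mult_braid by blast
  have over_mem: "over_edges \<tau> \<xi> \<in> apex ?S" if "\<xi> \<in> Ob X 2" for \<xi>
    using mem [OF swaps_edgesD(1) [OF \<tau>(2) that]] swaps_edgesD [OF \<tau>(2) that] that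
    by (simp add: over_edges_def)
  have "two_morphism ?S (Segal_mult X) k"
    unfolding two_morphism_def
  proof (intro conjI ballI)
    show "k \<in> apex ?S \<rightarrow>\<^sub>E apex (Segal_mult X)"
      using y swaps_edgesD(1) [OF \<tau>(2)] by (force simp: k_def Segal_mult_def)
    fix a assume a: "a \<in> apex ?S"
    then obtain \<xi> where \<xi>: "\<xi> \<in> Ob X 2" "a = ((sub 2 [1, 2] \<xi>, sub 2 [0, 1] \<xi>), \<xi>)" using y by blast
    have "k a = \<tau> \<xi>" using a \<xi>(2) by (simp add: k_def)
    then show "lleg (Segal_mult X) (k a) = lleg ?S a" "rleg (Segal_mult X) (k a) = rleg ?S a"
      using swaps_edgesD [OF \<tau>(2) \<xi>(1)] \<xi>(2)
      by (simp_all add: Segal_mult_def span_comp_def braid_def face_eq_sub)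
  qed
  moreover have "compose (apex (Segal_mult X)) k (over_edges \<tau>) = (\<lambda>a\<in>apex (Segal_mult X). a)"
    using over_mem \<tau>(3) by (auto simp: compose_def fun_eq_iff k_def Segal_mult_def over_edges_def)
  moreover have "compose (apex ?S) (over_edges \<tau>) k = (\<lambda>b\<in>apex ?S. b)"
  proof (rule ext)
    fix b
    show "compose (apex ?S) (over_edges \<tau>) k b = (\<lambda>b\<in>apex ?S. b) b"
    proof (cases "b \<in> apex ?S")
      case True
      then obtain \<xi> where \<xi>: "\<xi> \<in> Ob X 2" "b = ((sub 2 [1, 2] \<xi>, sub 2 [0, 1] \<xi>), \<xi>)" using y by blast
      have "k b = \<tau> \<xi>" using True \<xi>(2) by (simp add: k_def)
      then have "over_edges \<tau> (k b) = b"
        using swaps_edgesD [OF \<tau>(2) \<xi>(1)] \<tau>(3) \<xi> by (simp add: over_edges_def)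
      then show ?thesis using True by (simp add: compose_def)
    qed (simp add: compose_def)
  qed
  ultimately show ?thesis
    unfolding invertible_two_morphism_def using two_morphism_iff \<tau> by blast
qed

lemma commutative_structures_eq: "commutative_structures P = over_edges ` braidings"
proof -
  have P: "pmult P = Segal_mult X" "pobj P = Ob X 1" by (simp_all add: Segal_pseudomonoid_def)
  show ?thesis
  proof (intro set_eqI iffI)
    fix \<gamma> assume "\<gamma> \<in> commutative_structures P"
    then have \<gamma>: "two_morphism (Segal_mult X) (Segal_mult X \<circ>\<^sub>s braid (Ob X 1) (Ob X 1)) \<gamma>"
      "symmetry_axiom P \<gamma>" "hexagon_axiom P \<gamma>"
      unfolding commutative_structures_def invertible_two_morphism_def P by simp_all
    obtain \<tau> where \<tau>: "\<tau> \<in> Ob X 2 \<rightarrow>\<^sub>E Ob X 2" "swaps_edges \<tau>" "\<gamma> = over_edges \<tau>"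
      using \<gamma>(1) two_morphism_iff by blast
    then have "\<tau> \<in> braidings"
      using \<gamma>(2,3) symmetry_axiom_iff [OF \<tau>(2)] hexagon_axiom_iff [OF \<tau>(2)]
      unfolding braidings_def braided_iff by simp
    then show "\<gamma> \<in> over_edges ` braidings" using \<tau>(3) by blast
  next
    fix \<gamma> assume "\<gamma> \<in> over_edges ` braidings"
    then obtain \<tau> where \<tau>: "\<tau> \<in> Ob X 2 \<rightarrow>\<^sub>E Ob X 2" "braided_two_Segal_set X \<tau>" "\<gamma> = over_edges \<tau>"
      unfolding braidings_def by blast
    then show "\<gamma> \<in> commutative_structures P"
      unfolding commutative_structures_def P
      using over_edges_invertible symmetry_axiom_iff hexagon_axiom_iff braided_iff [of \<tau>] by auto
  qed
qed

lemma inj_over_edges: "inj_on over_edges braidings"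
proof (rule inj_onI)
  fix \<tau> \<tau>' assume \<tau>: "\<tau> \<in> braidings" "\<tau>' \<in> braidings" "over_edges \<tau> = over_edges \<tau>'"
  have "\<tau> \<xi> = \<tau>' \<xi>" if "\<xi> \<in> Ob X 2" for \<xi>
    using fun_cong [OF \<tau>(3), of \<xi>] that by (simp add: over_edges_def)
  then show "\<tau> = \<tau>'"
    using \<tau>(1,2) unfolding braidings_def by (auto intro: PiE_ext)
qed

lemma bij_betw_swap: "bij_betw Gamma_structure_on.swap (Gamma_structures X) braidings"
proof (rule bij_betw_byWitness [where f' = "braided_two_Segal_set.Gamma_functor X"])
  have G: "Gamma_structure_on X Y" if "Y \<in> Gamma_structures X" for Y
    using that by unfold_locales
  have swap: "Gamma_structure_on.swap Y \<in> Ob X 2 \<rightarrow>\<^sub>E Ob X 2"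
    "braided_two_Segal_set X (Gamma_structure_on.swap Y)"
    "braided_two_Segal_set.Gamma_functor X (Gamma_structure_on.swap Y) = Y" if "Y \<in> Gamma_structures X" for Y
  proof -
    interpret G: Gamma_structure_on X Y using that by (rule G)
    show "G.swap \<in> Ob X 2 \<rightarrow>\<^sub>E Ob X 2"
      unfolding G.swap_def by (rule PiE_mem [OF G.Ar_Y_extensional]) (rule indicator2_in_Pointed, auto)
    show "braided_two_Segal_set X G.swap" by unfold_locales
    show "G.Gamma_functor = Y" by (rule G.Gamma_functor_eq)
  qed
  then show "\<forall>Y \<in> Gamma_structures X.
      braided_two_Segal_set.Gamma_functor X (Gamma_structure_on.swap Y) = Y"
    and "Gamma_structure_on.swap ` Gamma_structures X \<subseteq> braidings"
    by (auto simp: braidings_def)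
  have Gamma: "braided_two_Segal_set.Gamma_functor X \<tau> \<in> Gamma_structures X"
    "\<And>\<xi>. \<xi> \<in> Ob X 2 \<Longrightarrow> Gamma_structure_on.swap (braided_two_Segal_set.Gamma_functor X \<tau>) \<xi> = \<tau> \<xi>"
    if "\<tau> \<in> braidings" for \<tau>
  proof -
    interpret B: braided_two_Segal_set X \<tau> using that by (simp add: braidings_def)
    show "B.Gamma_functor \<in> Gamma_structures X" by (rule B.Gamma_functor_structure)
    show "\<xi> \<in> Ob X 2 \<Longrightarrow> Gamma_structure_on.swap B.Gamma_functor \<xi> = \<tau> \<xi>" for \<xi>
      by (rule B.swap_Gamma_functor)
  qed
  then show "braided_two_Segal_set.Gamma_functor X ` braidings \<subseteq> Gamma_structures X" by blast
  show "\<forall>\<tau> \<in> braidings. Gamma_structure_on.swap (braided_two_Segal_set.Gamma_functor X \<tau>) = \<tau>"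
  proof
    fix \<tau> assume \<tau>: "\<tau> \<in> braidings"
    then have "\<tau> \<in> Ob X 2 \<rightarrow>\<^sub>E Ob X 2" by (simp add: braidings_def)
    then show "Gamma_structure_on.swap (braided_two_Segal_set.Gamma_functor X \<tau>) = \<tau>"
      using swap(1) [OF Gamma(1) [OF \<tau>]] Gamma(2) [OF \<tau>] by (auto intro: PiE_ext)
  qed
qed

end

section \<open>The correspondence\<close>

theorem theorem5p6:
  fixes X :: "'a set_functor"
  assumes "two_Segal X"
  shows "\<exists>F. bij_betw F (Gamma_structures X) (commutative_structures (Segal_pseudomonoid X))"
proof -
  interpret two_Segal_set X by unfold_locales fact
  have "bij_betw over_edges braidings (commutative_structures P)"
    unfolding commutative_structures_eq using inj_over_edges by (rule inj_on_imp_bij_betw)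
  then show ?thesis
    using bij_betw_trans [OF bij_betw_swap] by blast
qed

end
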